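(* Let $n=2\mathsf{r}$ with $\mathsf{r}\ge1$ and let $D=(2\varpi_{\mathsf r}-\varpi_0)[\infty]$ (no finite points). Write $T_D(z)$ in $\mathsf r\times\mathsf r$ block form and let $K$ be its lower-left block (rows $\mathsf r+1,\dots,2\mathsf r$, columns $1,\dots,\mathsf r$) and $\bar K$ its upper-right block (rows $1,\dots,\mathsf r$, columns $\mathsf r+1,\dots,2\mathsf r$). Then $K$ and $\bar K$ are independent of $z$ and $K\cdot\bar K=-I_{\mathsf r}$.
   Context: Let $\Lambda=\bigoplus_{j=1}^n\mathbb{Z}\epsilon_j$, $\alpha_i=\epsilon_i-\epsilon_{i+1}$, $\varpi_i=-\sum_{j=i+1}^n\epsilon_j$. Here $\mu=2\varpi_{\mathsf r}-\varpi_0=\sum_ia_i\alpha_i$ with $a_i=\min(i,2\mathsf r-i)$; $a_0=a_n=0$. $\mathcal{A}$: the $\mathbb{C}$-algebra generated by $p_{i,r},e^{\pm q_{i,r}},(p_{i,r}-p_{i,s}+m)^{-1}$ ($1\le i<n$, $1\le r\ne s\le a_i$, $m\in\mathbb{Z}$) with $[e^{\pm q_{i,r}},p_{j,s}]=\mp\delta_{ij}\delta_{rs}e^{\pm q_{i,r}}$, $p$'s commuting, $e^q$'s commuting, $e^{\pm q_{i,r}}e^{\mp q_{i,r}}=1$. $P_j(z)=\prod_{r=1}^{a_j}(z-p_{j,r})$, $P_{j,r}(z)=\prod_{s\ne r}(z-p_{j,s})$, $P_0=P_n=1$. $T_D(z)\in\mathcal{A}((z^{-1}))\otimes\mathrm{End}\,\mathbb{C}^n$: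 $T_D(z)_{\alpha\beta}=\sum_{i=1}^{\min(\alpha,\beta)}f^D_{\alpha i}(z)g^D_i(z)e^D_{i\beta}(z)$, where (expanded in $z^{-1}$) $g^D_i(z)=\frac{P_i(z)}{P_{i-1}(z-1)}$, $e^D_{ii}=f^D_{ii}=1$ and for $i<j$: $e^D_{ij}(z)=-\sum_{r_i,\dots,r_{j-1}}\frac{P_{i-1}(p_{i,r_i}-1)\prod_{k=i}^{j-2}P_{k,r_k}(p_{k+1,r_{k+1}}-1)}{(z-p_{i,r_i})\prod_{k=i}^{j-1}P_{k,r_k}(p_{k,r_k})}\, e^{\sum_{k=i}^{j-1}q_{k,r_k}}$, $f^D_{ji}(z)=\sum_{r_i,\dots,r_{j-1}}\frac{P_j(p_{j-1,r_{j-1}}+1)\prod_{k=i+1}^{j-1}P_{k,r_k}(p_{k-1,r_{k-1}}+1)}{(z-p_{i,r_i}-1)\prod_{k=i}^{j-1}P_{k,r_k}(p_{k,r_k})}\, e^{-\sum_{k=i}^{j-1}q_{k,r_k}}$ (sums over $1\le r_k\le a_k$). *)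

theory Defs
  imports Complex_Main "HOL-Computational_Algebra.Formal_Laurent_Series" "HOL-Library.FuncSet"
begin

text \<open>Two-sided inverse in a (possibly noncommutative) ring.  In the ring of
 formal Laurent series in w = z^{-1} this is exactly the expansion in z^{-1}.\<close>
definition ainv :: "'a::ring_1 \<Rightarrow> 'a" where
  "ainv x = (THE y. x * y = 1 \<and> y * x = 1)"

definition aa :: "nat \<Rightarrow> nat \<Rightarrow> nat" where
  "aa R i = min i (2 * R - i)"

text \<open>Index set of the generators p_{i,s}, e^{\<pm>q_{i,s}}: 1 \<le> i < n = 2r, 1 \<le> s \<le> a_i.\<close>
definition Vars :: "nat \<Rightarrow> (nat \<times> nat) set" where
  "Vars R = {(i, s). 1 \<le> i \<and> i < 2 * R \<and> 1 \<le> s \<and> s \<le> aa R i}"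

definition PP :: "nat \<Rightarrow> (nat \<Rightarrow> nat \<Rightarrow> 'a::ring_1) \<Rightarrow> nat \<Rightarrow> 'a \<Rightarrow> 'a" where
  "PP R p j x = prod_list (map (\<lambda>s. x - p j s) [1..<aa R j + 1])"

definition PPr :: "nat \<Rightarrow> (nat \<Rightarrow> nat \<Rightarrow> 'a::ring_1) \<Rightarrow> nat \<Rightarrow> nat \<Rightarrow> 'a \<Rightarrow> 'a" where
  "PPr R p j r x = prod_list (map (\<lambda>s. x - p j s) (filter (\<lambda>s. s \<noteq> r) [1..<aa R j + 1]))"

text \<open>Formal Laurent series in w = z^{-1}: the variable z is w^{-1}.\<close>
abbreviation Zv :: "'a::ring_1 fls" where "Zv \<equiv> fls_X_inv"

definition liftp :: "(nat \<Rightarrow> nat \<Rightarrow> 'a::ring_1) \<Rightarrow> nat \<Rightarrow> nat \<Rightarrow> 'a fls" where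
  "liftp p j s = fls_const (p j s)"

definition gD :: "nat \<Rightarrow> (nat \<Rightarrow> nat \<Rightarrow> 'a::ring_1) \<Rightarrow> nat \<Rightarrow> 'a fls" where
  "gD R p i = PP R (liftp p) i Zv * ainv (PP R (liftp p) (i - 1) (Zv - 1))"

definition eDo :: "nat \<Rightarrow> (nat \<Rightarrow> nat \<Rightarrow> 'a::ring_1) \<Rightarrow> (nat \<Rightarrow> nat \<Rightarrow> 'a)
                   \<Rightarrow> nat \<Rightarrow> nat \<Rightarrow> 'a fls" where
  "eDo R p ep i j = - (\<Sum>rr \<in> PiE {i..<j} (\<lambda>k. {1..aa R k}).
      fls_const (PP R p (i - 1) (p i (rr i) - 1)
                 * prod_list (map (\<lambda>k. PPr R p k (rr k) (p (k + 1) (rr (k + 1)) - 1)) [i..<j - 1]))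
      * ainv ((Zv - fls_const (p i (rr i)))
              * fls_const (prod_list (map (\<lambda>k. PPr R p k (rr k) (p k (rr k))) [i..<j])))
      * fls_const (prod_list (map (\<lambda>k. ep k (rr k)) [i..<j])))"

definition fDo :: "nat \<Rightarrow> (nat \<Rightarrow> nat \<Rightarrow> 'a::ring_1) \<Rightarrow> (nat \<Rightarrow> nat \<Rightarrow> 'a)
                   \<Rightarrow> nat \<Rightarrow> nat \<Rightarrow> 'a fls" where
  "fDo R p em j i = (\<Sum>rr \<in> PiE {i..<j} (\<lambda>k. {1..aa R k}).
      fls_const (PP R p j (p (j - 1) (rr (j - 1)) + 1)
                 * prod_list (map (\<lambda>k. PPr R p k (rr k) (p (k - 1) (rr (k - 1)) + 1)) [i + 1..<j]))
      * ainv ((Zv - fls_const (p i (rr i)) - 1)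
              * fls_const (prod_list (map (\<lambda>k. PPr R p k (rr k) (p k (rr k))) [i..<j])))
      * fls_const (prod_list (map (\<lambda>k. em k (rr k)) [i..<j])))"

definition eD :: "nat \<Rightarrow> (nat \<Rightarrow> nat \<Rightarrow> 'a::ring_1) \<Rightarrow> (nat \<Rightarrow> nat \<Rightarrow> 'a) \<Rightarrow> nat \<Rightarrow> nat \<Rightarrow> 'a fls" where
  "eD R p ep i j = (if i = j then 1 else eDo R p ep i j)"

definition fD :: "nat \<Rightarrow> (nat \<Rightarrow> nat \<Rightarrow> 'a::ring_1) \<Rightarrow> (nat \<Rightarrow> nat \<Rightarrow> 'a) \<Rightarrow> nat \<Rightarrow> nat \<Rightarrow> 'a fls" where
  "fD R p em j i = (if i = j then 1 else fDo R p em j i)"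

definition TD :: "nat \<Rightarrow> (nat \<Rightarrow> nat \<Rightarrow> 'a::ring_1) \<Rightarrow> (nat \<Rightarrow> nat \<Rightarrow> 'a) \<Rightarrow> (nat \<Rightarrow> nat \<Rightarrow> 'a)
                  \<Rightarrow> nat \<Rightarrow> nat \<Rightarrow> 'a fls" where
  "TD R p ep em \<alpha> \<beta> = (\<Sum>i \<in> {1..min \<alpha> \<beta>}. fD R p em \<alpha> i * gD R p i * eD R p ep i \<beta>)"

definition calg :: "(complex \<Rightarrow> 'a::ring_1) \<Rightarrow> bool" where
  "calg \<phi> \<longleftrightarrow> \<phi> 1 = 1 \<and> (\<forall>x y. \<phi> (x + y) = \<phi> x + \<phi> y) \<and> (\<forall>x y. \<phi> (x * y) = \<phi> x * \<phi> y)
     \<and> (\<forall>c y. \<phi> c * y = y * \<phi> c)"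

definition A_rels :: "nat \<Rightarrow> (nat \<Rightarrow> nat \<Rightarrow> 'a::ring_1) \<Rightarrow> (nat \<Rightarrow> nat \<Rightarrow> 'a) \<Rightarrow> (nat \<Rightarrow> nat \<Rightarrow> 'a) \<Rightarrow> bool" where
  "A_rels R p ep em \<longleftrightarrow>
    (\<forall>(i, s) \<in> Vars R. \<forall>(j, t) \<in> Vars R.
       p i s * p j t = p j t * p i s
     \<and> ep i s * ep j t = ep j t * ep i s
     \<and> em i s * em j t = em j t * em i s
     \<and> ep i s * em j t = em j t * ep i s
     \<and> ep i s * p j t - p j t * ep i s = (if i = j \<and> s = t then - ep i s else 0)
     \<and> em i s * p j t - p j t * em i s = (if i = j \<and> s = t then em i s else 0)
     \<and> (i = j \<and> s \<noteq> t \<longrightarrow> (\<forall>m::int. \<exists>y. (p i s - p i t + of_int m) * y = 1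
                                         \<and> y * (p i s - p i t + of_int m) = 1)))
  \<and> (\<forall>(i, s) \<in> Vars R. ep i s * em i s = 1 \<and> em i s * ep i s = 1)"

end

theory Submission
  imports Defs
begin

text \<open>
  The whole statement follows from the regularity of $T_D(z)$: no entry contains a negative power
  of $z$. Indeed $f_{\alpha i}$ and $e_{i\beta}$ off the diagonal are $O(z^{-1})$, while $g_i$ is
  $z + \dots$ for $i \le r$ and $z^{-1} + \dots$ for $i > r$. Hence the two off-diagonal blocks are
  $O(1)$, with constant terms the $z^{-1}$-coefficients $f^{(1)}_{\alpha\gamma}$ and
  $e^{(1)}_{\gamma\beta}$, and the $z^{-1}$-coefficient of the lower right block, which must vanish, is
  $\sum_\gamma f^{(1)}_{\alpha\gamma} e^{(1)}_{\gamma\beta} + \delta_{\alpha\beta}$.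

  Regularity is a telescoping of the sum over $i$ in $f g e$. Its $i$-th term has poles at $p_{i-1,t} + 1$ (from
  the denominator of $g_i$) and at $p_{i,t} + 1$ (from $f_{\alpha i}$, since the pole of
  $e_{i\beta}$ is cancelled by $P_i(z)$ unless $f_{\alpha i}$ has shifted it); Lagrange
  interpolation shows that the latter cancel against those of the next term.
\<close>

subsection \<open>Commuting elements and two-sided units\<close>

text \<open>The ring is arbitrary, so there is no field of fractions and no notion of residue to
  appeal to. Poles are handled inside Laurent series in z^{-1}, where z - c is a unit for every c: a
  pole at c is removed by exhibiting the numerator as a multiple of z - c. In the coefficient ring
  only differences p_{i,r} - p_{i,s} within one level, possibly shifted by 1, are inverted.

  Noncommutativity is confined to two vertices of level i+1: the first vertex t of a path in
  f_{\<alpha>,i+1} and the first vertex s of a path in e_{i+1,\<beta>}. Once e^{-q_{i+1,t}} has been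
  moved to the right, what stands before it is an identity between commuting p's and z. The shift it
  causes separates two cases. For s \<noteq> t the pole at p_{i+1,s} is a root of the factor
  P_{i+1,t}(z) that f leaves over. For s = t the exponentials e^{-q} and e^{q} of level i+1 cancel.
  The surviving poles therefore have exactly the shape of those left by the preceding term, one
  level higher. The chain starts from nothing because a_0 = 0, and it ends where f or e equals
  1.\<close>

definition commutes :: "'a::ring_1 \<Rightarrow> 'a \<Rightarrow> bool" where
  "commutes x y \<longleftrightarrow> x * y = y * x"

definition two_sided_unit :: "'a::ring_1 \<Rightarrow> bool" where
  "two_sided_unit x \<longleftrightarrow> (\<exists>y. x * y = 1 \<and> y * x = 1)"

lemma ainv_eqI: "x * y = 1 \<Longrightarrow> y * x = 1 \<Longrightarrow> ainv x = y"
  unfolding ainv_def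
  by (rule the_equality) (simp, metis mult.assoc mult_1_left mult_1_right)

lemma ainv_mult_self:
  assumes "two_sided_unit x"
  shows "x * ainv x = 1" "ainv x * x = 1"
  using assms ainv_eqI unfolding two_sided_unit_def by metis+

lemma ainv_mult_self_left:
  assumes "two_sided_unit x"
  shows "x * (ainv x * y) = y" "ainv x * (x * y) = y"
  using ainv_mult_self[OF assms] by (simp_all flip: mult.assoc)

lemma ainv_one [simp]: "ainv 1 = (1 :: 'a::ring_1)"
  by (rule ainv_eqI) auto

lemma two_sided_unit_one [simp]: "two_sided_unit 1"
  by (auto simp: two_sided_unit_def)

lemma
  assumes "two_sided_unit x" "two_sided_unit y"
  shows two_sided_unit_mult: "two_sided_unit (x * y)"
    and ainv_mult: "ainv (x * y) = ainv y * ainv x"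
proof -
  have *: "x * y * (ainv y * ainv x) = 1" "ainv y * ainv x * (x * y) = 1"
    using assms by (simp_all add: mult.assoc ainv_mult_self ainv_mult_self_left)
  show "two_sided_unit (x * y)" using * unfolding two_sided_unit_def by blast
  show "ainv (x * y) = ainv y * ainv x" by (rule ainv_eqI) (fact *)+
qed

lemma ainv_minus:
  assumes "two_sided_unit x"
  shows "ainv (- x) = - ainv x"
  using ainv_mult_self[OF assms] by (intro ainv_eqI) simp_all

text \<open>The resolvent identity, with the factors ordered so that \<open>x\<close> and
  \<open>y\<close> need not commute. It is the partial fraction step of
  \<open>lagrange_reciprocal\<close>.\<close>

lemma ainv_diff_ainv:
  assumes "two_sided_unit x" "two_sided_unit y"
  shows "ainv y - ainv x = ainv x * (x - y) * ainv y"
  using assms by (simp add: right_diff_distrib left_diff_distrib ainv_mult_self mult.assoc)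

lemma commutes_refl [simp]: "commutes x x"
  by (simp add: commutes_def)

lemma commutes_sym: "commutes x y \<Longrightarrow> commutes y x"
  by (simp add: commutes_def)

lemma commutes_one [simp]: "commutes 1 x" "commutes x 1"
  by (simp_all add: commutes_def)

lemma commutes_add_right: "commutes x y \<Longrightarrow> commutes x z \<Longrightarrow> commutes x (y + z)"
  by (simp add: commutes_def algebra_simps)

lemma commutes_diff_right: "commutes x y \<Longrightarrow> commutes x z \<Longrightarrow> commutes x (y - z)"
  by (simp add: commutes_def algebra_simps)

lemma commutes_mult_right: "commutes x y \<Longrightarrow> commutes x z \<Longrightarrow> commutes x (y * z)"
  by (simp add: commutes_def) (metis mult.assoc)

lemma commutes_ainv_right:
  assumes "commutes x y" "two_sided_unit y"
  shows "commutes x (ainv y)"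
proof -
  have "x * ainv y = ainv y * (y * x) * ainv y"
    using assms(2) by (simp add: ainv_mult_self_left mult.assoc)
  also have "\<dots> = ainv y * x"
    using assms by (simp add: commutes_def mult.assoc ainv_mult_self flip: assms(1)[unfolded commutes_def])
  finally show ?thesis by (simp add: commutes_def)
qed

lemma commutes_sum_right: "(\<And>i. i \<in> I \<Longrightarrow> commutes x (f i)) \<Longrightarrow> commutes x (sum f I)"
  by (simp add: commutes_def sum_distrib_left sum_distrib_right)

lemma commutes_prod_list_right:
  "(\<And>i. i \<in> set xs \<Longrightarrow> commutes x (f i)) \<Longrightarrow> commutes x (prod_list (map f xs))"
  by (induction xs) (auto intro: commutes_mult_right)

lemmas commutes_right =
  commutes_add_right commutes_diff_right commutes_mult_right commutes_ainv_right
  commutes_sum_right commutes_prod_list_right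



lemma commutes_left:
  "commutes y x \<Longrightarrow> commutes z x \<Longrightarrow> commutes (y + z) x"
  "commutes y x \<Longrightarrow> commutes z x \<Longrightarrow> commutes (y - z) x"
  "commutes y x \<Longrightarrow> commutes z x \<Longrightarrow> commutes (y * z) x"
  "commutes y x \<Longrightarrow> two_sided_unit y \<Longrightarrow> commutes (ainv y) x"
  "(\<And>i. i \<in> I \<Longrightarrow> commutes (f i) x) \<Longrightarrow> commutes (sum f I) x"
  "(\<And>j. j \<in> set xs \<Longrightarrow> commutes (g j) x) \<Longrightarrow> commutes (prod_list (map g xs)) x"
  by (meson commutes_sym commutes_right)+

lemma two_sided_unit_prod_list:
  "(\<And>i. i \<in> set xs \<Longrightarrow> two_sided_unit (f i)) \<Longrightarrow> two_sided_unit (prod_list (map f xs))"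
  by (induction xs) (auto intro: two_sided_unit_mult)

section \<open>Polynomials given by a list of roots\<close>

definition rootprod :: "('i \<Rightarrow> 'a::ring_1) \<Rightarrow> 'i list \<Rightarrow> 'a \<Rightarrow> 'a" where
  "rootprod c xs x = prod_list (map (\<lambda>s. x - c s) xs)"

lemma rootprod_Nil [simp]: "rootprod c [] x = 1"
  and rootprod_Cons [simp]: "rootprod c (a # xs) x = (x - c a) * rootprod c xs x"
  by (simp_all add: rootprod_def)

lemma commutes_rootprod_right:
  "commutes z x \<Longrightarrow> (\<And>s. s \<in> set xs \<Longrightarrow> commutes z (c s)) \<Longrightarrow> commutes z (rootprod c xs x)"
  unfolding rootprod_def by (auto intro!: commutes_right)

lemma commutes_rootprod_left:
  "commutes x z \<Longrightarrow> (\<And>s. s \<in> set xs \<Longrightarrow> commutes (c s) z) \<Longrightarrow> commutes (rootprod c xs x) z"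
  by (meson commutes_rootprod_right commutes_sym)

lemmas commutes_intros =
  commutes_right commutes_left commutes_rootprod_right commutes_rootprod_left

lemma two_sided_unit_rootprod:
  "(\<And>s. s \<in> set xs \<Longrightarrow> two_sided_unit (x - c s)) \<Longrightarrow> two_sided_unit (rootprod c xs x)"
  unfolding rootprod_def by (intro two_sided_unit_prod_list) auto

lemma rootprod_remove:
  assumes "distinct xs" "r \<in> set xs"
    and "\<And>s. s \<in> set xs \<Longrightarrow> commutes (x - c r) (x - c s)"
  shows "rootprod c xs x = (x - c r) * rootprod c (filter (\<lambda>s. s \<noteq> r) xs) x"
  using assms
proof (induction xs)
  case (Cons a xs)
  show ?case
  proof (cases "a = r")
    case True
    then have "filter (\<lambda>s. s \<noteq> r) xs = xs"
      using Cons.prems(1) by (auto simp: filter_id_conv)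
    then show ?thesis using True by simp
  next
    case False
    then have "rootprod c xs x = (x - c r) * rootprod c (filter (\<lambda>s. s \<noteq> r) xs) x"
      using Cons by auto
    moreover have "(x - c a) * (x - c r) = (x - c r) * (x - c a)"
      using Cons.prems(3)[of a] by (simp add: commutes_def)
    ultimately show ?thesis using False by (simp flip: mult.assoc)
  qed
qed simp

lemma rootprod_eq_0:
  assumes "r \<in> set xs" "x = c r"
  shows "rootprod c xs x = 0"
  using assms by (induction xs) auto

abbreviation without :: "'i list \<Rightarrow> 'i \<Rightarrow> 'i list" where
  "without xs r \<equiv> filter (\<lambda>s. s \<noteq> r) xs"

lemma without_not_in: "r \<notin> set xs \<Longrightarrow> without xs r = xs"
  by (auto simp: filter_id_conv)

lemma ainv_intertwine:
  assumes "e * x = x' * e" "two_sided_unit x" "two_sided_unit x'"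
  shows "e * ainv x = ainv x' * e"
proof -
  have "e * ainv x = ainv x' * (x' * e) * ainv x"
    using assms(3) by (simp add: ainv_mult_self_left)
  also have "\<dots> = ainv x' * e"
    using assms(1)[symmetric] assms(2) by (simp add: mult.assoc ainv_mult_self)
  finally show ?thesis .
qed

text \<open>An exponential passes through a polynomial by shifting its argument alone, provided that
  the one variable it shifts is not among the roots. This is why the omitted index in P_{i,r}
  matters.\<close>

lemma rootprod_intertwine:
  assumes "e * x = x' * e" "\<And>s. s \<in> set xs \<Longrightarrow> commutes e (c s)"
  shows "e * rootprod c xs x = rootprod c xs x' * (e :: 'b::ring_1)"
  using assms(2)
proof (induction xs)
  case (Cons a xs)
  have "e * (x - c a) = (x' - c a) * e"
    using assms(1) Cons.prems[of a] by (simp add: algebra_simps commutes_def)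
  then have "e * rootprod c (a # xs) x = (x' - c a) * (e * rootprod c xs x)"
    by (simp flip: mult.assoc)
  then show ?case using Cons by (simp add: mult.assoc)
qed simp

subsection \<open>Lagrange interpolation\<close>

text \<open>Partial fractions. The resolvent identity splits each product of
  \<open>ainv (u - c a)\<close> with a term of the induction hypothesis. The coefficient collected
  at \<open>ainv (u - c a)\<close> is again an instance of the induction hypothesis, now at the
  point \<open>c a\<close>; hence the induction must leave \<open>u\<close> arbitrary.\<close>

lemma lagrange_reciprocal:
  assumes "xs \<noteq> []" "distinct xs"
    and "\<And>r s. r \<in> set xs \<Longrightarrow> s \<in> set xs \<Longrightarrow> commutes (c r) (c s)"
    and "\<And>r s. r \<in> set xs \<Longrightarrow> s \<in> set xs \<Longrightarrow> r \<noteq> s \<Longrightarrow> two_sided_unit (c r - c s)"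
    and "\<And>r. r \<in> set xs \<Longrightarrow> commutes u (c r)"
    and "\<And>r. r \<in> set xs \<Longrightarrow> two_sided_unit (u - c r)"
  shows "ainv (rootprod c xs u)
    = (\<Sum>r\<in>set xs. ainv (u - c r) * ainv (rootprod c (without xs r) (c r)))"
  using assms
proof (induction xs arbitrary: u rule: list_nonempty_induct)
  case (single a)
  then show ?case by simp
next
  case (cons a xs)
  define D where "D r = rootprod c (without xs r) (c r)" for r
  have cm: "\<And>r s. r = a \<or> r \<in> set xs \<Longrightarrow> s = a \<or> s \<in> set xs \<Longrightarrow> commutes (c r) (c s)"
    and cmu: "\<And>r. r = a \<or> r \<in> set xs \<Longrightarrow> commutes u (c r)"
    and un: "\<And>r s. r = a \<or> r \<in> set xs \<Longrightarrow> s = a \<or> s \<in> set xs \<Longrightarrow> r \<noteq> s \<Longrightarrow> two_sided_unit (c r - c s)"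
    and unu: "\<And>r. r = a \<or> r \<in> set xs \<Longrightarrow> two_sided_unit (u - c r)"
    and a: "a \<notin> set xs"
    using cons.prems by auto
  have cmu': "\<And>r. r = a \<or> r \<in> set xs \<Longrightarrow> commutes (c r) u"
    using cmu commutes_sym by blast
  have ne: "r \<noteq> a" if "r \<in> set xs" for r using that a by auto
  have IH: "ainv (rootprod c xs v) = (\<Sum>r\<in>set xs. ainv (v - c r) * ainv (D r))"
    if "\<And>r. r \<in> set xs \<Longrightarrow> commutes v (c r)" "\<And>r. r \<in> set xs \<Longrightarrow> two_sided_unit (v - c r)" for v
    unfolding D_def by (rule cons.IH) (use cons.prems that in auto)
  have unD: "two_sided_unit (D r)" if "r \<in> set xs" for r
    unfolding D_def using that by (auto intro!: two_sided_unit_rootprod un)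
  have split: "ainv (u - c a) * ainv (u - c r) = (ainv (u - c r) - ainv (u - c a)) * ainv (c r - c a)"
    if r: "r \<in> set xs" for r
  proof -
    have "(ainv (u - c r) - ainv (u - c a)) = ainv (u - c a) * ((u - c a) - (u - c r)) * ainv (u - c r)"
      using r unu by (intro ainv_diff_ainv) auto
    also have "\<dots> = ainv (u - c a) * (ainv (u - c r) * (c r - c a))"
    proof -
      have "commutes (c r - c a) (ainv (u - c r))"
        using r by (auto intro!: commutes_intros cm cmu cmu' unu)
      then show ?thesis by (simp add: commutes_def mult.assoc)
    qed
    finally show ?thesis using r un[of r a] ne by (simp add: mult.assoc ainv_mult_self)
  qed
  have wo: "without (a # xs) a = xs" "\<And>r. r \<in> set xs \<Longrightarrow> without (a # xs) r = a # without xs r"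
    using a ne by (auto simp: filter_id_conv)
  have invD: "ainv (rootprod c (without (a # xs) r) (c r)) = ainv (c r - c a) * ainv (D r)"
    if r: "r \<in> set xs" for r
  proof -
    have "ainv (rootprod c (without (a # xs) r) (c r)) = ainv (D r) * ainv (c r - c a)"
      using r un[of r a] unD[OF r] ne[OF r] ne[OF r, symmetric] by (simp add: wo D_def ainv_mult)
    moreover have "commutes (ainv (D r)) (ainv (c r - c a))"
      using r unD[OF r] unfolding D_def by (auto intro!: commutes_intros cm un ne)
    ultimately show ?thesis by (simp add: commutes_def)
  qed
  have neg: "(\<Sum>r\<in>set xs. ainv (c r - c a) * ainv (D r)) = - ainv (rootprod c xs (c a))"
  proof -
    have "ainv (c r - c a) = - ainv (c a - c r)" if "r \<in> set xs" for r
      using ainv_minus[of "c a - c r"] that un[of a r] ne by auto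
    then show ?thesis using IH[of "c a"] un cm ne a
      by (simp add: sum_negf) (metis (no_types, lifting) ne)
  qed
  have "ainv (rootprod c (a # xs) u) = ainv (rootprod c xs u) * ainv (u - c a)"
    using unu by (simp add: ainv_mult two_sided_unit_rootprod)
  also have "\<dots> = ainv (u - c a) * ainv (rootprod c xs u)"
  proof -
    have "commutes (ainv (rootprod c xs u)) (ainv (u - c a))"
      by (auto intro!: commutes_intros cm cmu cmu' unu two_sided_unit_rootprod)
    then show ?thesis by (simp add: commutes_def)
  qed
  also have "\<dots> = (\<Sum>r\<in>set xs. ainv (u - c a) * ainv (u - c r) * ainv (D r))"
    using IH[of u] cmu unu by (simp add: sum_distrib_left mult.assoc)
  also have "\<dots> = (\<Sum>r\<in>set xs. ainv (u - c r) * (ainv (c r - c a) * ainv (D r)))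
      - ainv (u - c a) * (\<Sum>r\<in>set xs. ainv (c r - c a) * ainv (D r))"
    by (simp add: split sum_distrib_left left_diff_distrib sum_subtractf mult.assoc)
  also have "\<dots> = (\<Sum>r\<in>set (a # xs). ainv (u - c r) * ainv (rootprod c (without (a # xs) r) (c r)))"
    unfolding neg using a invD by (simp add: wo without_not_in)
  finally show ?case .
qed

text \<open>Interpolation of the constant 1 at the nodes \<open>c r\<close>. The usual derivation
  divides by \<open>y - c r\<close>; here the induction divides only by differences of nodes, and
  the error terms cancel by \<open>lagrange_reciprocal\<close> at the point
  \<open>c a\<close>.\<close>

lemma lagrange_one:
  assumes "xs \<noteq> []" "distinct xs"
    and "\<And>r s. r \<in> set xs \<Longrightarrow> s \<in> set xs \<Longrightarrow> commutes (c r) (c s)"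
    and "\<And>r s. r \<in> set xs \<Longrightarrow> s \<in> set xs \<Longrightarrow> r \<noteq> s \<Longrightarrow> two_sided_unit (c r - c s)"
    and "\<And>r. r \<in> set xs \<Longrightarrow> commutes y (c r)"
  shows "(\<Sum>r\<in>set xs. ainv (rootprod c (without xs r) (c r)) * rootprod c (without xs r) y) = 1"
  using assms
proof (induction xs rule: list_nonempty_induct)
  case (single a)
  then show ?case by simp
next
  case (cons a xs)
  define D where "D r = rootprod c (without xs r) (c r)" for r
  have cm: "\<And>r s. r = a \<or> r \<in> set xs \<Longrightarrow> s = a \<or> s \<in> set xs \<Longrightarrow> commutes (c r) (c s)"
    and cmy: "\<And>r. r = a \<or> r \<in> set xs \<Longrightarrow> commutes y (c r)"
    and un: "\<And>r s. r = a \<or> r \<in> set xs \<Longrightarrow> s = a \<or> s \<in> set xs \<Longrightarrow> r \<noteq> s \<Longrightarrow> two_sided_unit (c r - c s)"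
    and a: "a \<notin> set xs" and d: "distinct xs"
    using cons.prems by auto
  have cmy': "\<And>r. r = a \<or> r \<in> set xs \<Longrightarrow> commutes (c r) y"
    using cmy commutes_sym by blast
  have ne: "r \<noteq> a" if "r \<in> set xs" for r using that a by auto
  have IH: "(\<Sum>r\<in>set xs. ainv (D r) * rootprod c (without xs r) y) = 1"
    unfolding D_def by (rule cons.IH) (use cons.prems in auto)
  have unD: "two_sided_unit (D r)" if "r \<in> set xs" for r
    unfolding D_def using that by (auto intro!: two_sided_unit_rootprod un)
  have wo: "without (a # xs) a = xs" "\<And>r. r \<in> set xs \<Longrightarrow> without (a # xs) r = a # without xs r"
    using a ne by (auto simp: filter_id_conv)
  have summand: "ainv (rootprod c (without (a # xs) r) (c r)) * rootprod c (without (a # xs) r) y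
      = ainv (D r) * rootprod c (without xs r) y - (ainv (c a - c r) * ainv (D r)) * rootprod c xs y"
    if r: "r \<in> set xs" for r
  proof -
    have u: "two_sided_unit (c r - c a)" using un r ne by auto
    have "commutes (ainv (D r)) (ainv (c r - c a))"
      using r unD[OF r] u unfolding D_def by (auto intro!: commutes_intros cm)
    then have c1: "ainv (D r) * ainv (c r - c a) = ainv (c r - c a) * ainv (D r)"
      by (simp add: commutes_def)
    have "commutes (ainv (D r)) (c r - c a)"
      using r unD[OF r] unfolding D_def by (auto intro!: commutes_intros cm)
    then have c2: "ainv (D r) * (c r - c a) = (c r - c a) * ainv (D r)"
      by (simp add: commutes_def)
    \<comment> \<open>The first part cancels the new factor of the denominator and gives the old
      summand; the second completes the product to \<open>rootprod c xs y\<close>, which no longer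
      depends on \<open>r\<close> and can be pulled out of the sum.\<close>
    have y: "y - c a = (c r - c a) + (y - c r)" by simp
    have P: "rootprod c xs y = (y - c r) * rootprod c (without xs r) y"
      using r d by (intro rootprod_remove) (auto intro!: commutes_intros cm cmy cmy')
    have m: "ainv (c a - c r) = - ainv (c r - c a)"
      using ainv_minus[OF u] by simp
    have "ainv (rootprod c (without (a # xs) r) (c r)) * rootprod c (without (a # xs) r) y
       = ainv (c r - c a) * ainv (D r) * ((c r - c a) + (y - c r)) * rootprod c (without xs r) y"
      using r u unD[OF r] ne[OF r] ne[OF r, symmetric] y by (simp add: wo D_def[symmetric] ainv_mult c1 mult.assoc)
    also have "\<dots> = ainv (D r) * rootprod c (without xs r) y
        + ainv (c r - c a) * ainv (D r) * rootprod c xs y"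
      using c2 u by (simp only: P distrib_left distrib_right mult.assoc)
        (simp add: ainv_mult_self flip: mult.assoc)
    finally show ?thesis by (simp add: m)
  qed
  have "(\<Sum>r\<in>set (a # xs). ainv (rootprod c (without (a # xs) r) (c r)) * rootprod c (without (a # xs) r) y)
    = ainv (rootprod c xs (c a)) * rootprod c xs y
      + (1 - (\<Sum>r\<in>set xs. ainv (c a - c r) * ainv (D r)) * rootprod c xs y)"
    using a summand by (simp add: wo without_not_in sum_subtractf IH sum_distrib_right)
  also have "(\<Sum>r\<in>set xs. ainv (c a - c r) * ainv (D r)) = ainv (rootprod c xs (c a))"
    unfolding D_def by (rule lagrange_reciprocal[symmetric])
      (use cons.hyps d in \<open>auto intro!: cm un dest: ne\<close>)
  finally show ?case by simp
qed

text \<open>No difference \<open>y - c r\<close> needs to be invertible. This matters because $p_{i,r} - p_{i+1,s}$ is not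
  invertible in the algebra.\<close>

lemma lagrange_divided_difference:
  assumes "distinct xs"
    and cm: "\<And>r s. r \<in> set xs \<Longrightarrow> s \<in> set xs \<Longrightarrow> commutes (c r) (c s)"
    and un: "\<And>r s. r \<in> set xs \<Longrightarrow> s \<in> set xs \<Longrightarrow> r \<noteq> s \<Longrightarrow> two_sided_unit (c r - c s)"
    and cmu: "\<And>r. r \<in> set xs \<Longrightarrow> commutes u (c r)"
    and unu: "\<And>r. r \<in> set xs \<Longrightarrow> two_sided_unit (u - c r)"
    and cmy: "\<And>r. r \<in> set xs \<Longrightarrow> commutes y (c r)"
    and uy: "commutes u y" "two_sided_unit (u - y)"
  shows "(\<Sum>r\<in>set xs. ainv (u - c r) * ainv (rootprod c (without xs r) (c r)) * rootprod c (without xs r) y)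
    = ainv (u - y) * (1 - ainv (rootprod c xs u) * rootprod c xs y)"
\<comment> \<open>For the empty list both sides vanish, the right one as 1 - 1. This case does
  occur: level 0 has no variables.\<close>
proof (cases "xs = []")
  case False
  define D where "D r = rootprod c (without xs r) (c r)" for r
  define B where "B r = ainv (u - c r) * ainv (D r) * rootprod c (without xs r) y" for r
  have cmu': "\<And>r. r \<in> set xs \<Longrightarrow> commutes (c r) u" and cmy': "\<And>r. r \<in> set xs \<Longrightarrow> commutes (c r) y"
    and yu: "commutes y u"
    using cmu cmy uy commutes_sym by blast+
  have unD: "two_sided_unit (D r)" if "r \<in> set xs" for r
    unfolding D_def using that by (auto intro!: two_sided_unit_rootprod un)
  \<comment> \<open>In \<open>u - y = (u - c r) - (y - c r)\<close> the first part absorbs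
    \<open>ainv (u - c r)\<close> and the second completes the numerator. Summed over
    \<open>r\<close>, the results are \<open>lagrange_one\<close> and
    \<open>lagrange_reciprocal\<close>.\<close>
  have "(u - y) * B r = ainv (D r) * rootprod c (without xs r) y
      - ainv (u - c r) * ainv (D r) * rootprod c xs y" if r: "r \<in> set xs" for r
  proof -
    have P: "rootprod c xs y = (y - c r) * rootprod c (without xs r) y"
      using r assms(1) by (intro rootprod_remove) (auto intro!: commutes_intros cm cmy cmy')
    have "commutes (y - c r) (ainv (u - c r) * ainv (D r))"
      using r unD[OF r] unu[OF r] unfolding D_def
      by (auto intro!: commutes_intros cm cmy cmy' yu cmu')
    then have "(y - c r) * B r = ainv (u - c r) * ainv (D r) * rootprod c xs y"
      unfolding P B_def by (simp add: commutes_def flip: mult.assoc)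
    moreover have "(u - c r) * B r = ainv (D r) * rootprod c (without xs r) y"
      using unu[OF r] by (simp add: B_def ainv_mult_self_left mult.assoc)
    moreover have "u - y = (u - c r) - (y - c r)" by simp
    ultimately show ?thesis by (metis left_diff_distrib)
  qed
  then have "(u - y) * sum B (set xs) = 1 - ainv (rootprod c xs u) * rootprod c xs y"
    using lagrange_one[OF False assms(1) cm un cmy] lagrange_reciprocal[OF False assms(1) cm un cmu unu]
    by (simp add: sum_distrib_left sum_subtractf D_def sum_distrib_right)
  then have "sum B (set xs) = ainv (u - y) * (1 - ainv (rootprod c xs u) * rootprod c xs y)"
    using uy by (metis ainv_mult_self_left(2))
  then show ?thesis by (simp add: B_def D_def)
qed simp

subsection \<open>Polar parts\<close>

text \<open>Formal Laurent series are in the variable $z^{-1}$, so \<open>regular\<close> means polynomial in $z$.\<close>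

definition regular :: "'a::ring_1 fls \<Rightarrow> bool" where
  "regular f \<longleftrightarrow> (\<forall>d>0. fls_nth f d = 0)"

lemma regular_simps [simp]:
  "regular 0" "regular 1" "regular (fls_const a)" "regular Zv"
  by (auto simp: regular_def)

lemma regular_add: "regular f \<Longrightarrow> regular g \<Longrightarrow> regular (f + g)"
  and regular_diff: "regular f \<Longrightarrow> regular g \<Longrightarrow> regular (f - g)"
  and regular_minus: "regular f \<Longrightarrow> regular (- f)"
  by (auto simp: regular_def)

lemma regular_mult:
  assumes "regular f" "regular g"
  shows "regular (f * g)"
proof -
  have "fls_nth f i * fls_nth g (d - i) = 0" if "d > 0" for d i
    using assms that unfolding regular_def by (cases "i > 0") auto
  then show ?thesis
    unfolding regular_def fls_times_nth(2) by (intro allI impI sum.neutral ballI) blast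
qed

lemma regular_sum: "(\<And>i. i \<in> I \<Longrightarrow> regular (f i)) \<Longrightarrow> regular (sum f I)"
  by (induction I rule: infinite_finite_induct) (auto intro: regular_add)

lemma regular_rootprod:
  "regular x \<Longrightarrow> (\<And>s. s \<in> set xs \<Longrightarrow> regular (c s)) \<Longrightarrow> regular (rootprod c xs x)"
  by (induction xs) (auto intro: regular_mult regular_diff)

lemmas regular_intros = regular_add regular_diff regular_minus regular_mult regular_sum regular_rootprod

lemma commutes_Zv [simp]: "commutes Zv x" "commutes x Zv"
  by (simp_all add: commutes_def fls_X_inv_times_comm)

lemma commutes_fls_const [simp]: "commutes (fls_const a) (fls_const b) \<longleftrightarrow> commutes a b"
proof -
  have "fls_const x = fls_const y \<longleftrightarrow> x = y" for x y :: 'a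
    by (metis fls_const_nth)
  then show ?thesis by (simp add: commutes_def)
qed

lemma fls_const_rootprod:
  "fls_const (rootprod c xs x) = rootprod (\<lambda>s. fls_const (c s)) xs (fls_const x)"
  by (induction xs) (simp_all flip: fls_const_mult_const fls_minus_const)

lemma
  assumes "two_sided_unit a"
  shows two_sided_unit_fls_const: "two_sided_unit (fls_const a)"
    and fls_const_ainv: "fls_const (ainv a) = ainv (fls_const a)"
proof -
  have *: "fls_const a * fls_const (ainv a) = 1" "fls_const (ainv a) * fls_const a = 1"
    using ainv_mult_self[OF assms] by simp_all
  show "two_sided_unit (fls_const a)" using * unfolding two_sided_unit_def by blast
  show "fls_const (ainv a) = ainv (fls_const a)" by (metis * ainv_eqI)
qed

text \<open>The geometric series z^{-1} + c z^{-2} + ..., that is 1/(z - c) expanded at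
  infinity.\<close>

definition resolvent :: "'a::ring_1 \<Rightarrow> 'a fls" where
  "resolvent c = fls_X * fps_to_fls (Abs_fps (\<lambda>n. c ^ n))"

lemma resolvent_nth: "fls_nth (resolvent c) n = (if n < 1 then 0 else c ^ nat (n - 1))"
  by (simp add: resolvent_def fls_X_times_conv_shift)

lemma
  fixes c :: "'a::ring_1"
  shows two_sided_unit_Zv_diff: "two_sided_unit (Zv - fls_const c)"
    and ainv_Zv_diff: "ainv (Zv - fls_const c) = resolvent c"
proof -
  have eq: "c ^ nat n = c * c ^ nat (n - 1) \<and> c ^ nat n = c ^ nat (n - 1) * c" if "n > 0" for n :: int
  proof -
    have "nat n = Suc (nat (n - 1))" using that by simp
    then show ?thesis by (metis power_Suc power_Suc2)
  qed
  have *: "(Zv - fls_const c) * resolvent c = 1"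
    using eq by (intro fls_eqI) (auto simp: left_diff_distrib fls_X_inv_times_conv_shift resolvent_nth)
  have **: "resolvent c * (Zv - fls_const c) = 1"
    using eq by (intro fls_eqI)
      (auto simp: right_diff_distrib fls_X_inv_times_comm[symmetric] fls_X_inv_times_conv_shift
        resolvent_nth power_commutes)
  show "two_sided_unit (Zv - fls_const c)" using * ** unfolding two_sided_unit_def by blast
  show "ainv (Zv - fls_const c) = resolvent c" by (rule ainv_eqI) (fact * **)+
qed

lemma Zv_diff_shift: "Zv - 1 - fls_const c = Zv - fls_const (c + 1)"
  by (simp add: fls_plus_const[symmetric])

lemma two_sided_unit_Zv_shift_diff: "two_sided_unit (Zv - 1 - fls_const c)"
  by (simp add: Zv_diff_shift two_sided_unit_Zv_diff)

lemma ainv_Zv_shift_diff: "ainv (Zv - 1 - fls_const c) = resolvent (c + 1)"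
  by (simp add: Zv_diff_shift ainv_Zv_diff)

lemma rootprod_diff:
  assumes "\<And>s. s \<in> set xs \<Longrightarrow> commutes (d s) x" "regular x" "\<And>s. s \<in> set xs \<Longrightarrow> regular (d s)"
  shows "\<exists>q. regular q \<and> rootprod d xs Zv - rootprod d xs x = (Zv - x) * q"
  using assms
proof (induction xs)
  case (Cons a xs)
  then obtain q where q: "regular q" "rootprod d xs Zv - rootprod d xs x = (Zv - x) * q"
    by auto
  have "commutes (x - d a) (Zv - x)"
    using Cons.prems(1)[of a] by (auto intro!: commutes_intros)
  then have c: "(x - d a) * (Zv - x) = (Zv - x) * (x - d a)"
    by (simp add: commutes_def)
  have "rootprod d (a # xs) Zv - rootprod d (a # xs) x
    = (Zv - x) * rootprod d xs Zv + (x - d a) * (rootprod d xs Zv - rootprod d xs x)"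
    by (simp add: algebra_simps)
  also have "\<dots> = (Zv - x) * (rootprod d xs Zv + (x - d a) * q)"
    unfolding q(2) distrib_left by (simp add: c flip: mult.assoc)
  finally show ?case using q(1) Cons.prems
    by (intro exI[of _ "rootprod d xs Zv + (x - d a) * q"]) (auto intro!: regular_intros)
qed (auto intro: exI[of _ 0])

text \<open>The numerator vanishes at z = x, so the pole there is removable. Hence, modulo
  polynomials in z, a polynomial next to \<open>resolvent x\<close> may be replaced by its value at
  \<open>x\<close>.\<close>

lemma regular_resolvent_rootprod_diff:
  assumes "\<And>s. s \<in> set xs \<Longrightarrow> commutes (d s) x"
  shows "regular (resolvent x * (rootprod (\<lambda>s. fls_const (d s)) xs Zv - fls_const (rootprod d xs x)))"
proof -
  obtain q where q: "regular q" "rootprod (\<lambda>s. fls_const (d s)) xs Zv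
      - rootprod (\<lambda>s. fls_const (d s)) xs (fls_const x) = (Zv - fls_const x) * q"
    using rootprod_diff[of xs "\<lambda>s. fls_const (d s)" "fls_const x"] assms by auto
  show ?thesis unfolding fls_const_rootprod q(2)
    using q(1) by (simp add: two_sided_unit_Zv_diff ainv_mult_self_left flip: ainv_Zv_diff)
qed

text \<open>With $w = z - 1$, $P$ the polynomial with roots $c_r$, and $H(x)$ the product of the
  $x + 1 - d_u$: modulo polynomials in $z$,
  $\sum_r \frac{H(c_r) P_r(y)}{(w - c_r) P_r(c_r)} \equiv \frac{1}{w - y}\Bigl(H(y) - \frac{H(w)}{P(w)} P(y)\Bigr)$.\<close>

lemma bracket_regular:
  fixes c :: "'i \<Rightarrow> 'a::ring_1" and d :: "'j \<Rightarrow> 'a"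
  assumes dist: "distinct cs"
    and cc: "\<And>r s. r \<in> set cs \<Longrightarrow> s \<in> set cs \<Longrightarrow> commutes (c r) (c s)"
    and un: "\<And>r s. r \<in> set cs \<Longrightarrow> s \<in> set cs \<Longrightarrow> r \<noteq> s \<Longrightarrow> two_sided_unit (c r - c s)"
    and dc: "\<And>r u. r \<in> set cs \<Longrightarrow> u \<in> set xs \<Longrightarrow> commutes (d u) (c r)"
    and yc: "\<And>r. r \<in> set cs \<Longrightarrow> commutes y (c r)"
    and dy: "\<And>u. u \<in> set xs \<Longrightarrow> commutes (d u) y"
  shows "regular ((\<Sum>r\<in>set cs. resolvent (c r + 1) * fls_const (ainv (rootprod c (without cs r) (c r))
        * rootprod d xs (c r + 1) * rootprod c (without cs r) y))
      - resolvent (y + 1) * (fls_const (rootprod d xs (y + 1))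
         - rootprod (\<lambda>u. fls_const (d u)) xs Zv
           * ainv (rootprod (\<lambda>s. fls_const (c s)) cs (Zv - 1)) * fls_const (rootprod c cs y)))"
proof -
  define D where "D r = rootprod c (without cs r) (c r)" for r
  define H where "H = rootprod (\<lambda>u. fls_const (d u)) xs Zv"
  define P where "P = ainv (rootprod (\<lambda>s. fls_const (c s)) cs (Zv - 1))"
  define Y where "Y = fls_const (rootprod c cs y)"
  have cy: "\<And>r. r \<in> set cs \<Longrightarrow> commutes (c r) y" and cd: "\<And>r u. r \<in> set cs \<Longrightarrow> u \<in> set xs \<Longrightarrow> commutes (c r) (d u)"
    using yc dc commutes_sym by blast+
  have unD: "two_sided_unit (D r)" if "r \<in> set cs" for r
    unfolding D_def using that by (auto intro!: two_sided_unit_rootprod un)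
  have res: "commutes f (resolvent (a + 1))" if "commutes f (fls_const a)" for f and a :: 'a
    using that by (auto intro!: commutes_intros simp: two_sided_unit_Zv_shift_diff simp flip: ainv_Zv_shift_diff)
  have HR: "H * resolvent (a + 1) = resolvent (a + 1) * H" if "\<And>u. u \<in> set xs \<Longrightarrow> commutes (d u) a" for a
  proof -
    have "commutes H (fls_const a)"
      using that unfolding H_def by (auto intro!: commutes_intros)
    then show ?thesis using res[of H a] by (simp add: commutes_def)
  qed
  \<comment> \<open>Interpolation takes place in the ring of Laurent series at the point z - 1.
    There z - 1 - c_r and z - 1 - y are units, whatever c_r and y are.\<close>
  have "(\<Sum>r\<in>set cs. ainv (Zv - 1 - fls_const (c r))
        * ainv (rootprod (\<lambda>s. fls_const (c s)) (without cs r) (fls_const (c r)))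
        * rootprod (\<lambda>s. fls_const (c s)) (without cs r) (fls_const y))
    = ainv (Zv - 1 - fls_const y) * (1 - P * Y)"
    unfolding P_def Y_def fls_const_rootprod
    by (rule lagrange_divided_difference)
      (auto intro!: commutes_intros dist cc un yc two_sided_unit_Zv_shift_diff two_sided_unit_fls_const
        simp: fls_minus_const)
  moreover have "ainv (rootprod (\<lambda>s. fls_const (c s)) (without cs r) (fls_const (c r))) = fls_const (ainv (D r))"
    if "r \<in> set cs" for r
    using unD[OF that] by (simp add: D_def fls_const_ainv fls_const_rootprod)
  ultimately have L: "(\<Sum>r\<in>set cs. resolvent (c r + 1) * fls_const (ainv (D r) * rootprod c (without cs r) y))
      = resolvent (y + 1) * (1 - P * Y)"
    by (simp add: ainv_Zv_shift_diff fls_const_rootprod mult.assoc flip: fls_const_mult_const)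
  have term_eq: "resolvent (c r + 1) * fls_const (ainv (D r) * rootprod d xs (c r + 1) * rootprod c (without cs r) y)
      - H * (resolvent (c r + 1) * fls_const (ainv (D r) * rootprod c (without cs r) y))
    = - (resolvent (c r + 1) * (H - fls_const (rootprod d xs (c r + 1))))
        * fls_const (ainv (D r) * rootprod c (without cs r) y)" if r: "r \<in> set cs" for r
  proof -
    have "commutes (ainv (D r)) (rootprod d xs (c r + 1))"
      using r unD[OF r] unfolding D_def by (auto intro!: commutes_intros cc dc cd)
    then have "ainv (D r) * rootprod d xs (c r + 1) = rootprod d xs (c r + 1) * ainv (D r)"
      by (simp add: commutes_def)
    moreover have "H * resolvent (c r + 1) = resolvent (c r + 1) * H"
      using r by (intro HR dc)
    ultimately show ?thesis
      by (simp add: algebra_simps flip: mult.assoc fls_const_mult_const)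
  qed
  \<comment> \<open>Each value of the numerator at \<open>c r + 1\<close>, the pole of its summand,
    is traded for \<open>H\<close>, the numerator at z. Then \<open>H\<close> factors out and
    \<open>L\<close> evaluates the sum; \<open>reg2\<close> trades \<open>H\<close> back at the pole
    \<open>y + 1\<close>.\<close>
  have reg1: "regular ((\<Sum>r\<in>set cs. resolvent (c r + 1)
        * fls_const (ainv (D r) * rootprod d xs (c r + 1) * rootprod c (without cs r) y))
      - H * (\<Sum>r\<in>set cs. resolvent (c r + 1) * fls_const (ainv (D r) * rootprod c (without cs r) y)))"
    unfolding sum_distrib_left sum_subtractf[symmetric] H_def
    by (rule regular_sum, subst term_eq[unfolded H_def])
      (auto intro!: regular_mult regular_minus regular_resolvent_rootprod_diff commutes_intros dc)
  have reg2: "regular (resolvent (y + 1) * (H - fls_const (rootprod d xs (y + 1))))"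
    unfolding H_def by (rule regular_resolvent_rootprod_diff) (auto intro!: commutes_intros dy)
  have e: "H * (resolvent (y + 1) * (1 - P * Y)) + - (resolvent (y + 1) * (fls_const (rootprod d xs (y + 1)) - H * P * Y))
    = resolvent (y + 1) * (H - fls_const (rootprod d xs (y + 1)))"
    using HR[of y] dy by (simp add: algebra_simps flip: mult.assoc)
  have cancel: "f - g + (g + - h) = f - h" for f g h :: "'a fls" by simp
  show ?thesis
    using regular_add[OF reg1 reg2] unfolding L e[symmetric] cancel
    unfolding D_def H_def P_def Y_def .
qed

text \<open>The version for a right factor e = 1, where no point \<open>y\<close> enters: partial
  fractions of H(z)/P(z - 1), each numerator replaced by its value at the pole.\<close>

lemma bracket_regular_end:
  fixes c :: "'i \<Rightarrow> 'a::ring_1" and d :: "'j \<Rightarrow> 'a"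
  assumes dist: "distinct cs"
    and cc: "\<And>r s. r \<in> set cs \<Longrightarrow> s \<in> set cs \<Longrightarrow> commutes (c r) (c s)"
    and un: "\<And>r s. r \<in> set cs \<Longrightarrow> s \<in> set cs \<Longrightarrow> r \<noteq> s \<Longrightarrow> two_sided_unit (c r - c s)"
    and dc: "\<And>r u. r \<in> set cs \<Longrightarrow> u \<in> set xs \<Longrightarrow> commutes (d u) (c r)"
  shows "regular ((\<Sum>r\<in>set cs. resolvent (c r + 1) * fls_const (ainv (rootprod c (without cs r) (c r))
        * rootprod d xs (c r + 1)))
      - rootprod (\<lambda>u. fls_const (d u)) xs Zv * ainv (rootprod (\<lambda>s. fls_const (c s)) cs (Zv - 1)))"
proof (cases "cs = []")
  case True
  then show ?thesis by (auto intro!: regular_intros)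
next
  case False
  define D where "D r = rootprod c (without cs r) (c r)" for r
  define H where "H = rootprod (\<lambda>u. fls_const (d u)) xs Zv"
  have cd: "\<And>r u. r \<in> set cs \<Longrightarrow> u \<in> set xs \<Longrightarrow> commutes (c r) (d u)"
    using dc commutes_sym by blast
  have unD: "two_sided_unit (D r)" if "r \<in> set cs" for r
    unfolding D_def using that by (auto intro!: two_sided_unit_rootprod un)
  have "ainv (rootprod (\<lambda>s. fls_const (c s)) cs (Zv - 1))
    = (\<Sum>r\<in>set cs. ainv (Zv - 1 - fls_const (c r))
        * ainv (rootprod (\<lambda>s. fls_const (c s)) (without cs r) (fls_const (c r))))"
    by (rule lagrange_reciprocal)
      (auto intro!: commutes_intros False dist cc un two_sided_unit_Zv_shift_diff two_sided_unit_fls_const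
        simp: fls_minus_const)
  also have "\<dots> = (\<Sum>r\<in>set cs. resolvent (c r + 1) * fls_const (ainv (D r)))"
    using unD by (simp add: D_def ainv_Zv_shift_diff fls_const_ainv fls_const_rootprod)
  finally have L: "ainv (rootprod (\<lambda>s. fls_const (c s)) cs (Zv - 1)) = \<dots>" .
  have term_eq: "resolvent (c r + 1) * fls_const (ainv (D r) * rootprod d xs (c r + 1))
      - H * (resolvent (c r + 1) * fls_const (ainv (D r)))
    = - (resolvent (c r + 1) * (H - fls_const (rootprod d xs (c r + 1)))) * fls_const (ainv (D r))"
    if r: "r \<in> set cs" for r
  proof -
    have "commutes (ainv (D r)) (rootprod d xs (c r + 1))"
      using r unD[OF r] unfolding D_def by (auto intro!: commutes_intros cc dc cd)
    then have "ainv (D r) * rootprod d xs (c r + 1) = rootprod d xs (c r + 1) * ainv (D r)"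
      by (simp add: commutes_def)
    moreover have "commutes H (resolvent (c r + 1))"
      using r unfolding H_def
      by (auto intro!: commutes_intros dc simp: two_sided_unit_Zv_shift_diff simp flip: ainv_Zv_shift_diff)
    then have "H * resolvent (c r + 1) = resolvent (c r + 1) * H"
      by (simp add: commutes_def)
    ultimately show ?thesis
      by (simp add: algebra_simps flip: mult.assoc fls_const_mult_const)
  qed
  show ?thesis
    unfolding L sum_distrib_left sum_subtractf[symmetric] D_def[symmetric]
    by (rule regular_sum, subst term_eq[unfolded H_def])
      (auto intro!: regular_mult regular_minus regular_resolvent_rootprod_diff commutes_intros dc)
qed

subsection \<open>Leading coefficients\<close>

text \<open>The coefficient \<open>c\<close> may be zero.\<close>

definition has_lead :: "int \<Rightarrow> 'a::ring_1 \<Rightarrow> 'a fls \<Rightarrow> bool" where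
  "has_lead k c f \<longleftrightarrow> (\<forall>d<k. fls_nth f d = 0) \<and> fls_nth f k = c"

lemma has_lead_mult:
  assumes f: "has_lead k c f" and g: "has_lead l d g"
  shows "has_lead (k + l) (c * d) (f * g)"
proof -
  have z: "fls_nth f i * fls_nth g (n - i) = (if n = k + l \<and> i = k then c * d else 0)" if "n \<le> k + l" for n i
    using f g that unfolding has_lead_def by (cases i k rule: linorder_cases) auto
  have nth: "fls_nth (f * g) n = (\<Sum>i = fls_subdegree f..n - fls_subdegree g. if n = k + l \<and> i = k then c * d else 0)"
    if "n \<le> k + l" for n
    unfolding fls_times_nth(2) using that by (intro sum.cong) (auto simp: z)
  \<comment> \<open>The convolution runs only between the subdegrees and may miss the index
    \<open>k\<close>. That happens only when \<open>c\<close> or \<open>d\<close> is zero.\<close>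
  have "c * d = 0" if "k \<notin> {fls_subdegree f..k + l - fls_subdegree g}"
  proof -
    have "c = fls_nth f k" "d = fls_nth g l" using f g by (auto simp: has_lead_def)
    moreover have "k < fls_subdegree f \<or> l < fls_subdegree g" using that by auto
    ultimately show ?thesis by auto
  qed
  then show ?thesis unfolding has_lead_def by (auto simp: nth sum.delta' sum.delta)
qed

lemma has_lead_one: "has_lead 0 1 1"
  by (simp add: has_lead_def)

lemma has_lead_Zv_diff: "has_lead (- 1) 1 (Zv - fls_const c)"
  by (simp add: has_lead_def)

lemma has_lead_resolvent: "has_lead 1 1 (resolvent c)"
  by (simp add: has_lead_def resolvent_nth)

lemma has_lead_fls_const: "has_lead 0 c (fls_const c)"
  by (simp add: has_lead_def)

lemma has_lead_nth: "has_lead k c f \<Longrightarrow> has_lead k (fls_nth f k) f"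
  by (simp add: has_lead_def)

lemma has_lead_sum:
  "(\<And>i. i \<in> I \<Longrightarrow> has_lead k (c i) (f i)) \<Longrightarrow> has_lead k (sum c I) (sum f I)"
  by (auto simp: has_lead_def fls_nth_sum intro!: sum.neutral sum.cong)

lemma has_lead_minus: "has_lead k c f \<Longrightarrow> has_lead k (- c) (- f)"
  by (simp add: has_lead_def)

lemma has_lead_sum_resolvent:
  "has_lead 1 (sum d I) (\<Sum>i\<in>I. resolvent (c i) * fls_const (d i))"
  using has_lead_mult[OF has_lead_resolvent has_lead_fls_const] by (intro has_lead_sum) fastforce

lemma has_lead_rootprod: "has_lead (- int (length xs)) 1 (rootprod (\<lambda>s. fls_const (c s)) xs Zv)"
proof (induction xs)
  case (Cons a xs)
  then show ?case
    using has_lead_mult[OF has_lead_Zv_diff[of "c a"]] by fastforce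
qed (simp add: has_lead_one)

lemma has_lead_ainv_rootprod:
  "has_lead (int (length xs)) 1 (ainv (rootprod (\<lambda>s. fls_const (c s)) xs (Zv - 1)))"
proof (induction xs)
  case (Cons a xs)
  have "two_sided_unit (rootprod (\<lambda>s. fls_const (c s)) xs (Zv - 1))"
    by (auto intro!: two_sided_unit_rootprod two_sided_unit_Zv_shift_diff)
  then have "ainv (rootprod (\<lambda>s. fls_const (c s)) (a # xs) (Zv - 1))
      = ainv (rootprod (\<lambda>s. fls_const (c s)) xs (Zv - 1)) * resolvent (c a + 1)"
    by (simp add: ainv_mult two_sided_unit_Zv_shift_diff ainv_Zv_shift_diff)
  then show ?case
    using has_lead_mult[OF Cons.IH has_lead_resolvent[of "c a + 1"]] by (simp add: add.commute)
qed (simp add: has_lead_one)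

section \<open>Index lists and the products P_i\<close>

definition idx :: "nat \<Rightarrow> nat \<Rightarrow> nat list" where
  "idx R i = [1..<aa R i + 1]"

lemma set_idx: "set (idx R i) = {1..aa R i}"
  by (auto simp: idx_def)

lemma distinct_idx [simp]: "distinct (idx R i)"
  by (simp add: idx_def)

lemma length_idx [simp]: "length (idx R i) = aa R i"
  by (simp add: idx_def)

lemma fls_const_sum: "fls_const (sum f I) = (\<Sum>i\<in>I. fls_const (f i :: 'a::ring_1))"
  by (induction I rule: infinite_finite_induct) (simp_all flip: fls_plus_const)

lemma PP_conv_rootprod: "PP R q i x = rootprod (q i) (idx R i) x"
  by (simp add: PP_def rootprod_def idx_def)

lemma PPr_conv_rootprod: "PPr R q i r x = rootprod (q i) (without (idx R i) r) x"
  by (simp add: PPr_def rootprod_def idx_def)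

text \<open>The bounds on \<open>i\<close> come for free: \<open>aa R i\<close> is 0 at
  \<open>i = 0\<close> and, by truncated subtraction, for every \<open>i \<ge> 2 * R\<close>.
  Statements about all levels therefore need no case distinction on the range.\<close>

lemma Vars_iff: "(i, s) \<in> Vars R \<longleftrightarrow> s \<in> set (idx R i)"
  by (auto simp: Vars_def aa_def set_idx)

lemma sum_PiE_insert:
  assumes "i \<notin> I"
  shows "(\<Sum>rr\<in>PiE (insert i I) T. h rr) = (\<Sum>s\<in>T i. \<Sum>rr\<in>PiE I T. h (rr(i := s)))"
proof -
  have "(\<Sum>rr\<in>PiE (insert i I) T. h rr) = sum (h \<circ> (\<lambda>(s, rr). rr(i := s))) (T i \<times> PiE I T)"
    unfolding PiE_insert_eq using assms by (intro sum.reindex inj_combinator)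
  also have "\<dots> = (\<Sum>s\<in>T i. \<Sum>rr\<in>PiE I T. h (rr(i := s)))"
    by (simp add: sum.cartesian_product case_prod_unfold)
  finally show ?thesis .
qed

lemma liftp_conv: "liftp q i = (\<lambda>s. fls_const (q i s))"
  by (simp add: liftp_def fun_eq_iff)

subsection \<open>The difference operators\<close>

locale difference_operators =
  fixes R :: nat and p ep em :: "nat \<Rightarrow> nat \<Rightarrow> 'a::ring_1"
  assumes A_rels: "A_rels R p ep em"
begin

lemma rels:
  assumes "s \<in> set (idx R i)" "t \<in> set (idx R j)"
  shows "p i s * p j t = p j t * p i s"
    "em i s * em j t = em j t * em i s"
    "ep i s * p j t - p j t * ep i s = (if i = j \<and> s = t then - ep i s else 0)"
    "em i s * p j t - p j t * em i s = (if i = j \<and> s = t then em i s else 0)"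
    "i = j \<Longrightarrow> s \<noteq> t \<Longrightarrow> \<exists>y. (p i s - p i t + of_int m) * y = 1 \<and> y * (p i s - p i t + of_int m) = 1"
    "em i s * ep i s = 1"
proof -
  have "(i, s) \<in> Vars R" "(j, t) \<in> Vars R" using assms Vars_iff by blast+
  then show "p i s * p j t = p j t * p i s"
    "em i s * em j t = em j t * em i s"
    "ep i s * p j t - p j t * ep i s = (if i = j \<and> s = t then - ep i s else 0)"
    "em i s * p j t - p j t * em i s = (if i = j \<and> s = t then em i s else 0)"
    "i = j \<Longrightarrow> s \<noteq> t \<Longrightarrow> \<exists>y. (p i s - p i t + of_int m) * y = 1 \<and> y * (p i s - p i t + of_int m) = 1"
    "em i s * ep i s = 1"
    using A_rels unfolding A_rels_def by fast+
qed

lemma commutes_p: "s \<in> set (idx R i) \<Longrightarrow> t \<in> set (idx R j) \<Longrightarrow> commutes (p i s) (p j t)"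
  using rels(1) by (simp add: commutes_def)

lemma commutes_em: "s \<in> set (idx R i) \<Longrightarrow> t \<in> set (idx R j) \<Longrightarrow> commutes (em i s) (em j t)"
  using rels(2) by (simp add: commutes_def)

lemma commutes_ep_p:
  assumes "s \<in> set (idx R i)" "t \<in> set (idx R j)" "i \<noteq> j \<or> s \<noteq> t"
  shows "commutes (ep i s) (p j t)" "commutes (p j t) (ep i s)"
  using rels(3)[OF assms(1,2)] assms(3) by (auto simp: commutes_def)

lemma commutes_em_p:
  assumes "s \<in> set (idx R i)" "t \<in> set (idx R j)" "i \<noteq> j \<or> s \<noteq> t"
  shows "commutes (em i s) (p j t)" "commutes (p j t) (em i s)"
  using rels(4)[OF assms(1,2)] assms(3) by (auto simp: commutes_def)

lemma em_p_shift: "s \<in> set (idx R i) \<Longrightarrow> em i s * p i s = (p i s + 1) * em i s"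
  using rels(4)[of s i s i] by (simp add: algebra_simps)

lemma em_ep: "s \<in> set (idx R i) \<Longrightarrow> em i s * ep i s = 1"
  using rels(6)[of s i s i] by simp

text \<open>The relations with m = 0 and m = 1. The first inverts P_{i,s}(p_{i,s}), the second its
  image under the shift by \<open>em i s\<close>.\<close>

lemma two_sided_unit_p_diff:
  assumes "s \<in> set (idx R i)" "t \<in> set (idx R i)" "s \<noteq> t"
  shows "two_sided_unit (p i s - p i t)" "two_sided_unit (p i s + 1 - p i t)"
  using rels(5)[OF assms(1,2), of 0] rels(5)[OF assms(1,2), of 1] assms(3)
  by (auto simp: two_sided_unit_def algebra_simps)

section \<open>Denominators and their shifts\<close>

definition denom :: "nat \<Rightarrow> nat \<Rightarrow> 'a" where
  "denom i s = rootprod (p i) (without (idx R i) s) (p i s)"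

lemma two_sided_unit_denom: "s \<in> set (idx R i) \<Longrightarrow> two_sided_unit (denom i s)"
  unfolding denom_def by (auto intro!: two_sided_unit_rootprod two_sided_unit_p_diff)

definition denom_shift :: "nat \<Rightarrow> nat \<Rightarrow> 'a" where
  "denom_shift i s = rootprod (p i) (without (idx R i) s) (p i s + 1)"

lemma two_sided_unit_denom_shift: "s \<in> set (idx R i) \<Longrightarrow> two_sided_unit (denom_shift i s)"
  unfolding denom_shift_def by (auto intro!: two_sided_unit_rootprod two_sided_unit_p_diff)

text \<open>Conjugation by \<open>em i s\<close> raises \<open>p i s\<close> by 1 and fixes the
  other roots of the denominator. This is the cancellation of exponentials in the middle of f g e
  when both paths start at the same vertex.\<close>

lemma em_denom_ep:
  assumes "s \<in> set (idx R i)"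
  shows "em i s * (ainv (denom i s) * ep i s) = ainv (denom_shift i s)"
proof -
  have "em i s * denom i s = denom_shift i s * em i s"
    unfolding denom_def denom_shift_def using assms
    by (intro rootprod_intertwine em_p_shift commutes_em_p) auto
  then have "ainv (denom_shift i s) * (em i s * denom i s) * ainv (denom i s) = em i s * ainv (denom i s)"
    using two_sided_unit_denom two_sided_unit_denom_shift assms
    by (metis ainv_mult_self_left(2))
  then have "em i s * ainv (denom i s) = ainv (denom_shift i s) * em i s"
    using two_sided_unit_denom[OF assms] by (simp add: mult.assoc ainv_mult_self)
  then show ?thesis using em_ep[OF assms] by (metis mult.assoc mult_1_right)
qed

text \<open>The path sums factor over the first vertex:
  $e_{i\beta} = -\sum_s (z - p_{i,s})^{-1} P_{i-1}(p_{i,s} - 1) P_{i,s}(p_{i,s})^{-1} e^{q_{i,s}}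
  V_{i,s}$ and
  $f_{\alpha i} = \sum_r (z - p_{i,r} - 1)^{-1} P_{i,r}(p_{i,r})^{-1} W_{i,r} e^{-q_{i,r}}$,
  where $V$ (\<open>e_tail\<close>) only involves levels above $i$ and $W$ (\<open>f_tail\<close>)
  commutes with the $p$'s of level at most $i$. The first argument counts the remaining steps,
  $\beta - i - 1$ and $\alpha - i - 1$.\<close>

primrec e_tail :: "nat \<Rightarrow> nat \<Rightarrow> nat \<Rightarrow> 'a" where
  "e_tail 0 i s = 1"
| "e_tail (Suc n) i s = (\<Sum>t\<in>set (idx R (Suc i)). rootprod (p i) (without (idx R i) s) (p (Suc i) t - 1)
      * (ainv (denom (Suc i) t) * ep (Suc i) t * e_tail n (Suc i) t))"

primrec f_tail :: "nat \<Rightarrow> nat \<Rightarrow> nat \<Rightarrow> 'a" where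
  "f_tail 0 i r = rootprod (p (Suc i)) (idx R (Suc i)) (p i r + 1)"
| "f_tail (Suc n) i r = (\<Sum>t\<in>set (idx R (Suc i)). rootprod (p (Suc i)) (without (idx R (Suc i)) t) (p i r + 1)
      * (ainv (denom (Suc i) t) * f_tail n (Suc i) t * em (Suc i) t))"

lemma commutes_ainv_denom:
  assumes "\<And>t. t \<in> set (idx R i) \<Longrightarrow> commutes (p i t) x" "s \<in> set (idx R i)"
  shows "commutes (ainv (denom i s)) x"
  using assms two_sided_unit_denom[OF assms(2)] unfolding denom_def by (auto intro!: commutes_intros)

lemma commutes_f_tail_p:
  assumes "r \<in> set (idx R i)" "s \<in> set (idx R j)" "j \<le> i"
  shows "commutes (f_tail n i r) (p j s)"
  using assms
proof (induction n arbitrary: i r)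
  case 0
  then show ?case by (auto intro!: commutes_intros commutes_p)
next
  case (Suc n)
  then show ?case
    by (auto intro!: commutes_intros commutes_p commutes_em_p commutes_ainv_denom Suc.IH)
qed

section \<open>Factorisation of the path sums\<close>

text \<open>One summand of the sum for e, stripped of its sign and of the factors P_{i-1}(p_{i,r_i}
  - 1) and (z - p_{i,r_i})^{-1}. These belong to the starting level and would spoil a recursion
  along the path; \<open>fpath\<close> omits its resolvent for the same reason.\<close>

definition epath :: "nat \<Rightarrow> nat \<Rightarrow> (nat \<Rightarrow> nat) \<Rightarrow> 'a" where
  "epath n i rr = prod_list (map (\<lambda>k. PPr R p k (rr k) (p (k + 1) (rr (k + 1)) - 1)) [i..<i + n])
     * ainv (prod_list (map (\<lambda>k. denom k (rr k)) [i..<Suc (i + n)]))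
     * prod_list (map (\<lambda>k. ep k (rr k)) [i..<Suc (i + n)])"

definition fpath :: "nat \<Rightarrow> nat \<Rightarrow> (nat \<Rightarrow> nat) \<Rightarrow> 'a" where
  "fpath n i rr = PP R p (Suc (i + n)) (p (i + n) (rr (i + n)) + 1)
     * prod_list (map (\<lambda>k. PPr R p k (rr k) (p (k - 1) (rr (k - 1)) + 1)) [i + 1..<Suc (i + n)])
     * ainv (prod_list (map (\<lambda>k. denom k (rr k)) [i..<Suc (i + n)]))
     * prod_list (map (\<lambda>k. em k (rr k)) [i..<Suc (i + n)])"

text \<open>\<open>ep i (rr i)\<close> shifts only \<open>p i (rr i)\<close>. The numerator linking
  levels i and i+1 omits exactly that root, and all later factors live on higher levels, so the
  exponential can be moved to the left of them.\<close>

lemma epath_Suc: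
  assumes rr: "\<And>k. i \<le> k \<Longrightarrow> k \<le> Suc (i + n) \<Longrightarrow> rr k \<in> set (idx R k)"
  shows "epath (Suc n) i rr = ainv (denom i (rr i)) * ep i (rr i)
    * rootprod (p i) (without (idx R i) (rr i)) (p (Suc i) (rr (Suc i)) - 1) * epath n (Suc i) rr"
proof -
  define a where "a = rootprod (p i) (without (idx R i) (rr i)) (p (Suc i) (rr (Suc i)) - 1)"
  define N where "N = prod_list (map (\<lambda>k. PPr R p k (rr k) (p (k + 1) (rr (k + 1)) - 1)) [Suc i..<Suc i + n])"
  define Q where "Q = prod_list (map (\<lambda>k. denom k (rr k)) [Suc i..<Suc (Suc i + n)])"
  define E where "E = prod_list (map (\<lambda>k. ep k (rr k)) [Suc i..<Suc (Suc i + n)])"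
  have l: "[i..<i + Suc n] = i # [Suc i..<Suc i + n]" "[i..<Suc (i + Suc n)] = i # [Suc i..<Suc (Suc i + n)]"
    by (simp_all add: upt_conv_Cons del: upt_Suc)
  have u: "two_sided_unit (denom i (rr i))" "two_sided_unit Q"
    using rr unfolding Q_def by (auto intro!: two_sided_unit_denom two_sided_unit_prod_list simp del: upt_Suc)
  have c2: "commutes (ainv (denom i (rr i))) (a * (N * ainv Q))"
    using rr u unfolding a_def N_def Q_def PPr_conv_rootprod
    by (auto intro!: commutes_intros commutes_p commutes_ainv_denom simp: denom_def simp del: upt_Suc)
  have "commutes (ep i (rr i)) (p k s)" if "k > i" "s \<in> set (idx R k)" for k s
    using that rr[of i] by (intro commutes_ep_p) auto
  moreover have "commutes (ep i (rr i)) (p i s)" if "s \<in> set (without (idx R i) (rr i))" for s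
    using that rr[of i] by (intro commutes_ep_p) auto
  ultimately have c3: "commutes (ep i (rr i)) a" "commutes (ep i (rr i)) N" "commutes (ep i (rr i)) Q"
    using rr unfolding a_def N_def Q_def PPr_conv_rootprod denom_def
    by (auto intro!: commutes_right commutes_rootprod_right simp del: upt_Suc)
  have c1: "commutes (ainv (denom i (rr i)) * ep i (rr i)) (a * (N * ainv Q))"
    using c3 u by (intro commutes_left(3) c2 commutes_mult_right commutes_ainv_right)
  have "epath (Suc n) i rr = a * (N * ainv Q) * ainv (denom i (rr i)) * (ep i (rr i) * E)"
    unfolding epath_def l using u
    by (simp add: a_def N_def Q_def E_def ainv_mult PPr_conv_rootprod mult.assoc del: upt_Suc)
  also have "\<dots> = (a * (N * ainv Q)) * (ainv (denom i (rr i)) * ep i (rr i)) * E"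
    by (simp add: mult.assoc)
  also have "\<dots> = (ainv (denom i (rr i)) * ep i (rr i)) * (a * (N * ainv Q)) * E"
    using c1 by (simp add: commutes_def)
  finally show ?thesis by (simp add: a_def epath_def N_def Q_def E_def mult.assoc del: upt_Suc)
qed

text \<open>Here the linking numerator is evaluated at \<open>p i (rr i) + 1\<close>, which
  \<open>em i (rr i)\<close> shifts. So the exponential goes to the right end instead, passing only
  the other \<open>em\<close>.\<close>

lemma fpath_Suc:
  assumes rr: "\<And>k. i \<le> k \<Longrightarrow> k \<le> Suc (i + n) \<Longrightarrow> rr k \<in> set (idx R k)"
  shows "fpath (Suc n) i rr = ainv (denom i (rr i))
    * rootprod (p (Suc i)) (without (idx R (Suc i)) (rr (Suc i))) (p i (rr i) + 1)
    * fpath n (Suc i) rr * em i (rr i)"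
proof -
  define a where "a = rootprod (p (Suc i)) (without (idx R (Suc i)) (rr (Suc i))) (p i (rr i) + 1)"
  define P where "P = PP R p (Suc (Suc i + n)) (p (Suc i + n) (rr (Suc i + n)) + 1)"
  define N where "N = prod_list (map (\<lambda>k. PPr R p k (rr k) (p (k - 1) (rr (k - 1)) + 1)) [Suc i + 1..<Suc (Suc i + n)])"
  define Q where "Q = prod_list (map (\<lambda>k. denom k (rr k)) [Suc i..<Suc (Suc i + n)])"
  define E where "E = prod_list (map (\<lambda>k. em k (rr k)) [Suc i..<Suc (Suc i + n)])"
  have l: "[i + 1..<Suc (i + Suc n)] = Suc i # [Suc i + 1..<Suc (Suc i + n)]"
    "[i..<Suc (i + Suc n)] = i # [Suc i..<Suc (Suc i + n)]"
    by (simp_all add: upt_conv_Cons del: upt_Suc)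
  have u: "two_sided_unit (denom i (rr i))" "two_sided_unit Q"
    using rr unfolding Q_def by (auto intro!: two_sided_unit_denom two_sided_unit_prod_list simp del: upt_Suc)
  have c1: "commutes (ainv (denom i (rr i))) (P * a * (N * ainv Q))"
    using rr u unfolding P_def a_def N_def Q_def PPr_conv_rootprod PP_conv_rootprod
    by (auto intro!: commutes_intros commutes_p commutes_ainv_denom simp: denom_def simp del: upt_Suc)
  have c2: "commutes P a"
    using rr unfolding P_def a_def PP_conv_rootprod by (auto intro!: commutes_intros commutes_p)
  have c3: "commutes (em i (rr i)) E"
    using rr unfolding E_def by (auto intro!: commutes_intros commutes_em simp del: upt_Suc)
  have "fpath (Suc n) i rr = P * a * (N * ainv Q) * ainv (denom i (rr i)) * (em i (rr i) * E)"
    unfolding fpath_def l using u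
    by (simp add: a_def P_def N_def Q_def E_def ainv_mult PPr_conv_rootprod mult.assoc del: upt_Suc)
  also have "\<dots> = ainv (denom i (rr i)) * (a * P) * (N * ainv Q) * (E * em i (rr i))"
    using c1 c2 c3 unfolding commutes_def by (simp add: mult.assoc)
  finally show ?thesis by (simp add: a_def fpath_def P_def N_def Q_def E_def mult.assoc del: upt_Suc)
qed

text \<open>The weight \<open>g\<close> is arbitrary because the induction moves the starting point:
  the factors linking first and second vertex become part of the weight of the second.\<close>

lemma sum_epath:
  "(\<Sum>rr\<in>PiE {i..<Suc (i + n)} (\<lambda>k. {1..aa R k}). g (rr i) * fls_const (epath n i rr))
    = (\<Sum>s\<in>set (idx R i). g s * fls_const (ainv (denom i s) * ep i s * e_tail n i s))"
proof (induction n arbitrary: i g)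
  case 0
  have "PiE {i..<Suc (i + 0)} T = PiE (insert i {}) T" for T :: "nat \<Rightarrow> nat set" by simp
  then show ?case by (simp only: sum_PiE_insert empty_iff not_False_eq_True)
    (simp add: epath_def set_idx)
next
  case (Suc n)
  define S where "S = PiE {Suc i..<Suc (Suc i + n)} (\<lambda>k. {1..aa R k})"
  have "epath n (Suc i) (rr(i := s)) = epath n (Suc i) rr" for rr s
    unfolding epath_def by (intro arg_cong2[where f = "(*)"] arg_cong[where f = prod_list]
      arg_cong[where f = ainv] map_cong) auto
  then have step: "epath (Suc n) i (rr(i := s)) = ainv (denom i s) * ep i s
      * rootprod (p i) (without (idx R i) s) (p (Suc i) (rr (Suc i)) - 1) * epath n (Suc i) rr"
    if "s \<in> set (idx R i)" "rr \<in> S" for s rr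
    using that by (subst epath_Suc) (auto simp: S_def PiE_iff set_idx)
  have ins: "{i..<Suc (i + Suc n)} = insert i {Suc i..<Suc (Suc i + n)}" by auto
  have "(\<Sum>rr\<in>PiE {i..<Suc (i + Suc n)} (\<lambda>k. {1..aa R k}). g (rr i) * fls_const (epath (Suc n) i rr))
    = (\<Sum>s\<in>{1..aa R i}. \<Sum>rr\<in>S. g s * fls_const (epath (Suc n) i (rr(i := s))))"
    unfolding ins S_def by (subst sum_PiE_insert) simp_all
  also have "\<dots> = (\<Sum>s\<in>set (idx R i). \<Sum>rr\<in>S. (g s * fls_const (ainv (denom i s) * ep i s
      * rootprod (p i) (without (idx R i) s) (p (Suc i) (rr (Suc i)) - 1))) * fls_const (epath n (Suc i) rr))"
    by (intro sum.cong) (auto simp: step set_idx mult.assoc simp flip: fls_const_mult_const)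
  also have "\<dots> = (\<Sum>s\<in>set (idx R i). g s * fls_const (ainv (denom i s) * ep i s * e_tail (Suc n) i s))"
    unfolding S_def
    by (subst Suc.IH) (simp add: mult.assoc sum_distrib_left fls_const_sum flip: fls_const_mult_const)
  finally show ?case .
qed

lemma sum_fpath:
  "(\<Sum>rr\<in>PiE {i..<Suc (i + n)} (\<lambda>k. {1..aa R k}). g (rr i) * fls_const (fpath n i rr))
    = (\<Sum>s\<in>set (idx R i). g s * fls_const (ainv (denom i s) * f_tail n i s * em i s))"
proof (induction n arbitrary: i g)
  case 0
  have "PiE {i..<Suc (i + 0)} T = PiE (insert i {}) T" for T :: "nat \<Rightarrow> nat set" by simp
  moreover have "PP R p (Suc i) (p i s + 1) * ainv (denom i s) = ainv (denom i s) * rootprod (p (Suc i)) (idx R (Suc i)) (p i s + 1)"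
    if "s \<in> set (idx R i)" for s
  proof -
    have "commutes (PP R p (Suc i) (p i s + 1)) (ainv (denom i s))"
      using that two_sided_unit_denom[OF that] unfolding PP_conv_rootprod denom_def
      by (auto intro!: commutes_intros commutes_p)
    then show ?thesis by (simp add: commutes_def PP_conv_rootprod)
  qed
  ultimately show ?case by (simp only: sum_PiE_insert empty_iff not_False_eq_True)
    (simp add: fpath_def set_idx)
next
  case (Suc n)
  define S where "S = PiE {Suc i..<Suc (Suc i + n)} (\<lambda>k. {1..aa R k})"
  have "fpath n (Suc i) (rr(i := s)) = fpath n (Suc i) rr" for rr s
    unfolding fpath_def by (intro arg_cong2[where f = "(*)"] arg_cong[where f = prod_list]
      arg_cong[where f = ainv] map_cong) auto
  then have step: "fpath (Suc n) i (rr(i := s)) = ainv (denom i s)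
      * rootprod (p (Suc i)) (without (idx R (Suc i)) (rr (Suc i))) (p i s + 1) * fpath n (Suc i) rr * em i s"
    if "s \<in> set (idx R i)" "rr \<in> S" for s rr
    using that by (subst fpath_Suc) (auto simp: S_def PiE_iff set_idx)
  have ins: "{i..<Suc (i + Suc n)} = insert i {Suc i..<Suc (Suc i + n)}" by auto
  have "(\<Sum>rr\<in>PiE {i..<Suc (i + Suc n)} (\<lambda>k. {1..aa R k}). g (rr i) * fls_const (fpath (Suc n) i rr))
    = (\<Sum>s\<in>{1..aa R i}. \<Sum>rr\<in>S. g s * fls_const (fpath (Suc n) i (rr(i := s))))"
    unfolding ins S_def by (subst sum_PiE_insert) simp_all
  also have "\<dots> = (\<Sum>s\<in>set (idx R i). (\<Sum>rr\<in>S. (g s * fls_const (ainv (denom i s)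
      * rootprod (p (Suc i)) (without (idx R (Suc i)) (rr (Suc i))) (p i s + 1))) * fls_const (fpath n (Suc i) rr))
      * fls_const (em i s))"
    unfolding sum_distrib_right
    by (intro sum.cong) (auto simp: step set_idx mult.assoc simp flip: fls_const_mult_const)
  also have "\<dots> = (\<Sum>s\<in>set (idx R i). g s * fls_const (ainv (denom i s) * f_tail (Suc n) i s * em i s))"
    unfolding S_def
    by (subst Suc.IH) (simp add: mult.assoc sum_distrib_left sum_distrib_right fls_const_sum flip: fls_const_mult_const)
  finally show ?case .
qed

lemma eDo_eq:
  "eDo R p ep i (Suc (i + n)) = - (\<Sum>s\<in>set (idx R i). resolvent (p i s)
     * fls_const (rootprod (p (i - 1)) (idx R (i - 1)) (p i s - 1) * (ainv (denom i s) * ep i s * e_tail n i s)))"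
proof -
  have "fls_const (PP R p (i - 1) (p i (rr i) - 1)
        * prod_list (map (\<lambda>k. PPr R p k (rr k) (p (k + 1) (rr (k + 1)) - 1)) [i..<Suc (i + n) - 1]))
      * ainv ((Zv - fls_const (p i (rr i)))
              * fls_const (prod_list (map (\<lambda>k. PPr R p k (rr k) (p k (rr k))) [i..<Suc (i + n)])))
      * fls_const (prod_list (map (\<lambda>k. ep k (rr k)) [i..<Suc (i + n)]))
    = resolvent (p i (rr i)) * fls_const (PP R p (i - 1) (p i (rr i) - 1)) * fls_const (epath n i rr)"
    if rr: "rr \<in> PiE {i..<Suc (i + n)} (\<lambda>k. {1..aa R k})" for rr
  proof -
    have mem: "rr k \<in> set (idx R k)" if "i \<le> k" "k < Suc (i + n)" for k
      using rr that by (auto simp: PiE_iff set_idx)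
    define N where "N = PP R p (i - 1) (p i (rr i) - 1)
        * prod_list (map (\<lambda>k. PPr R p k (rr k) (p (k + 1) (rr (k + 1)) - 1)) [i..<i + n])"
    define Q where "Q = prod_list (map (\<lambda>k. denom k (rr k)) [i..<Suc (i + n)])"
    have u: "two_sided_unit Q"
      using mem unfolding Q_def by (auto intro!: two_sided_unit_denom two_sided_unit_prod_list simp del: upt_Suc)
    have "commutes (N * ainv Q) (p i (rr i))"
      using mem u unfolding N_def Q_def PP_conv_rootprod PPr_conv_rootprod denom_def
      by (auto intro!: commutes_intros commutes_p simp del: upt_Suc)
    then have "commutes (fls_const (N * ainv Q)) (resolvent (p i (rr i)))"
      unfolding ainv_Zv_diff[symmetric] by (intro commutes_intros two_sided_unit_Zv_diff) auto
    then have "fls_const N * ainv ((Zv - fls_const (p i (rr i))) * fls_const Q)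
      = resolvent (p i (rr i)) * fls_const (N * ainv Q)"
      using u by (simp add: ainv_mult two_sided_unit_Zv_diff two_sided_unit_fls_const ainv_Zv_diff
          commutes_def fls_const_ainv[symmetric] mult.assoc[symmetric])
    moreover have "(\<lambda>k. PPr R p k (rr k) (p k (rr k))) = (\<lambda>k. denom k (rr k))"
      by (simp add: denom_def PPr_conv_rootprod)
    ultimately show ?thesis
      by (simp add: epath_def N_def Q_def mult.assoc flip: fls_const_mult_const del: upt_Suc)
  qed
  then have "eDo R p ep i (Suc (i + n)) = - (\<Sum>rr\<in>PiE {i..<Suc (i + n)} (\<lambda>k. {1..aa R k}).
      resolvent (p i (rr i)) * fls_const (PP R p (i - 1) (p i (rr i) - 1)) * fls_const (epath n i rr))"
    unfolding eDo_def by (intro arg_cong[where f = uminus] sum.cong) auto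
  then show ?thesis
    using sum_epath[of "\<lambda>s. resolvent (p i s) * fls_const (PP R p (i - 1) (p i s - 1))"]
    by (simp add: PP_conv_rootprod mult.assoc flip: fls_const_mult_const)
qed

lemma fDo_eq:
  "fDo R p em (Suc (i + n)) i = (\<Sum>r\<in>set (idx R i). resolvent (p i r + 1)
     * fls_const (ainv (denom i r) * f_tail n i r * em i r))"
proof -
  have "fls_const (PP R p (Suc (i + n)) (p (Suc (i + n) - 1) (rr (Suc (i + n) - 1)) + 1)
        * prod_list (map (\<lambda>k. PPr R p k (rr k) (p (k - 1) (rr (k - 1)) + 1)) [i + 1..<Suc (i + n)]))
      * ainv ((Zv - fls_const (p i (rr i)) - 1)
              * fls_const (prod_list (map (\<lambda>k. PPr R p k (rr k) (p k (rr k))) [i..<Suc (i + n)])))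
      * fls_const (prod_list (map (\<lambda>k. em k (rr k)) [i..<Suc (i + n)]))
    = resolvent (p i (rr i) + 1) * fls_const (fpath n i rr)"
    if rr: "rr \<in> PiE {i..<Suc (i + n)} (\<lambda>k. {1..aa R k})" for rr
  proof -
    have mem: "rr k \<in> set (idx R k)" if "i \<le> k" "k < Suc (i + n)" for k
      using rr that by (auto simp: PiE_iff set_idx)
    define N where "N = PP R p (Suc (i + n)) (p (i + n) (rr (i + n)) + 1)
        * prod_list (map (\<lambda>k. PPr R p k (rr k) (p (k - 1) (rr (k - 1)) + 1)) [i + 1..<Suc (i + n)])"
    define Q where "Q = prod_list (map (\<lambda>k. denom k (rr k)) [i..<Suc (i + n)])"
    have u: "two_sided_unit Q"
      using mem unfolding Q_def by (auto intro!: two_sided_unit_denom two_sided_unit_prod_list simp del: upt_Suc)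
    have "commutes (N * ainv Q) (p i (rr i))"
      using mem u unfolding N_def Q_def PP_conv_rootprod PPr_conv_rootprod denom_def
      by (auto intro!: commutes_intros commutes_p simp del: upt_Suc)
    then have "commutes (fls_const (N * ainv Q)) (resolvent (p i (rr i) + 1))"
      unfolding ainv_Zv_diff[symmetric] by (intro commutes_intros two_sided_unit_Zv_diff) (auto intro: commutes_add_right)
    moreover have z: "Zv - fls_const (p i (rr i)) - 1 = Zv - fls_const (p i (rr i) + 1)"
      by (simp add: fls_plus_const[symmetric])
    ultimately have "fls_const N * ainv ((Zv - fls_const (p i (rr i)) - 1) * fls_const Q)
      = resolvent (p i (rr i) + 1) * fls_const (N * ainv Q)"
      unfolding z using u by (simp add: ainv_mult two_sided_unit_Zv_diff two_sided_unit_fls_const ainv_Zv_diff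
          commutes_def fls_const_ainv[symmetric] mult.assoc[symmetric])
    moreover have "(\<lambda>k. PPr R p k (rr k) (p k (rr k))) = (\<lambda>k. denom k (rr k))"
      by (simp add: denom_def PPr_conv_rootprod)
    ultimately show ?thesis
      by (simp add: fpath_def N_def Q_def mult.assoc flip: fls_const_mult_const del: upt_Suc)
  qed
  then have "fDo R p em (Suc (i + n)) i = (\<Sum>rr\<in>PiE {i..<Suc (i + n)} (\<lambda>k. {1..aa R k}).
      resolvent (p i (rr i) + 1) * fls_const (fpath n i rr))"
    unfolding fDo_def by (intro sum.cong) auto
  then show ?thesis
    using sum_fpath[of "\<lambda>r. resolvent (p i r + 1)"] by simp
qed

section \<open>Telescoping of the polar parts\<close>

definition recip :: "nat \<Rightarrow> 'a fls" where
  "recip i = ainv (rootprod (liftp p i) (idx R i) (Zv - 1))"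

lemma gD_eq: "gD R p (Suc i) = rootprod (liftp p (Suc i)) (idx R (Suc i)) Zv * recip i"
  by (simp add: gD_def PP_conv_rootprod recip_def)

lemma two_sided_unit_rootprod_shift:
  "two_sided_unit (rootprod (liftp p i) (idx R i) (Zv - 1))"
  by (auto intro!: two_sided_unit_rootprod two_sided_unit_Zv_shift_diff simp: liftp_def)

lemma commutes_recip:
  assumes "\<And>r. r \<in> set (idx R i) \<Longrightarrow> commutes f (fls_const (p i r))"
  shows "commutes f (recip i)"
  unfolding recip_def using assms
  by (intro commutes_ainv_right commutes_rootprod_right two_sided_unit_rootprod_shift)
    (auto intro!: commutes_diff_right simp: liftp_def)

lemma commutes_resolvent:
  assumes "commutes f (fls_const a)"
  shows "commutes f (resolvent a)"
  using assms unfolding ainv_Zv_diff[symmetric]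
  by (intro commutes_ainv_right two_sided_unit_Zv_diff commutes_diff_right) auto

text \<open>The hypotheses cover both $i + 1 < \alpha$, where \<open>T\<close> runs over the second vertex of the
  path and \<open>\<Phi> t\<close> shifts $p_{i+1,t}$, and $i + 1 = \alpha$, where $f = 1$ and \<open>T\<close> is a dummy
  singleton. The value \<open>y t s\<close> is $p_{i+1,s} - 1$ after \<open>\<Phi> t\<close> has been moved to its right.\<close>

lemma telescope_step_aux:
  fixes \<Phi> E :: "nat \<Rightarrow> 'a" and y :: "nat \<Rightarrow> nat \<Rightarrow> 'a" and T :: "nat set" and xs :: "nat \<Rightarrow> nat list"
  assumes xs: "\<And>t. t \<in> T \<Longrightarrow> set (xs t) \<subseteq> set (idx R (Suc i))"
    and \<Phi>c: "\<And>t r. t \<in> T \<Longrightarrow> r \<in> set (idx R i) \<Longrightarrow> commutes (\<Phi> t) (p i r)"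
    and \<Phi>d: "\<And>t s. t \<in> T \<Longrightarrow> s \<in> set (idx R (Suc i)) \<Longrightarrow> \<Phi> t * p (Suc i) s = (y t s + 1) * \<Phi> t"
    and y: "\<And>t s. t \<in> T \<Longrightarrow> s \<in> set (idx R (Suc i)) \<Longrightarrow> y t s = p (Suc i) s \<or> y t s = p (Suc i) s - 1"
  defines "S \<equiv> set (idx R (Suc i))"
  shows "regular ((\<Sum>t\<in>T. rootprod (liftp p (Suc i)) (xs t) Zv * fls_const (\<Phi> t)) * recip i
      * - (\<Sum>s\<in>S. resolvent (p (Suc i) s) * fls_const (rootprod (p i) (idx R i) (p (Suc i) s - 1) * E s))
    - (\<Sum>r\<in>set (idx R i). resolvent (p i r + 1) * fls_const (ainv (denom i r)
        * (\<Sum>t\<in>T. rootprod (p (Suc i)) (xs t) (p i r + 1) * \<Phi> t)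
        * (\<Sum>s\<in>S. rootprod (p i) (without (idx R i) r) (p (Suc i) s - 1) * E s)))
    + (\<Sum>t\<in>T. \<Sum>s\<in>S. resolvent (y t s + 1)
        * fls_const (rootprod (p (Suc i)) (xs t) (y t s + 1) * \<Phi> t * E s)))"
    (is "regular (?X - ?U + ?Z)")
proof -
  define H where "H t = rootprod (liftp p (Suc i)) (xs t) Zv" for t
  define B where "B t s = (\<Sum>r\<in>set (idx R i). resolvent (p i r + 1) * fls_const (ainv (denom i r)
        * rootprod (p (Suc i)) (xs t) (p i r + 1) * rootprod (p i) (without (idx R i) r) (y t s)))" for t s
  define G where "G t s = resolvent (y t s + 1) * (fls_const (rootprod (p (Suc i)) (xs t) (y t s + 1))
         - H t * recip i * fls_const (rootprod (p i) (idx R i) (y t s)))" for t s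
  have yc: "commutes (y t s) (p j u)" "commutes (p j u) (y t s)"
    if "t \<in> T" "s \<in> S" "u \<in> set (idx R j)" for t s j u
    using that y[of t s] by (auto simp: S_def intro!: commutes_intros commutes_p)
  \<comment> \<open>For fixed \<open>t\<close> and \<open>s\<close>, with \<open>\<Phi> t\<close>
    and \<open>E s\<close> split off on the right, only p's and z are left. So the commutative
    bracket applies, with the level i variables as nodes and \<open>y t s\<close> as the extra
    point.\<close>
  have "regular (B t s - G t s)" if "t \<in> T" "s \<in> S" for t s
    unfolding B_def G_def denom_def H_def recip_def liftp_conv
    using that xs[of t] by (intro bracket_regular) (auto intro: commutes_p two_sided_unit_p_diff yc)
  then have reg: "regular (- (\<Sum>t\<in>T. \<Sum>s\<in>S. (B t s - G t s) * fls_const (\<Phi> t * E s)))"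
    by (intro regular_minus regular_sum regular_mult) auto
  \<comment> \<open>The facts \<open>A\<close>, \<open>Bt\<close> and \<open>C\<close> carry
    \<open>\<Phi> t\<close> to the right through P_i(z - 1)^{-1}, the resolvent of e and the
    polynomials at \<open>p (Suc i) s - 1\<close>. On the way \<open>p (Suc i) s\<close> turns into
    \<open>y t s + 1\<close>.\<close>
  have A: "fls_const (\<Phi> t) * (recip i * f) = recip i * (fls_const (\<Phi> t) * f)" if "t \<in> T" for t f
  proof -
    have "commutes (fls_const (\<Phi> t)) (recip i)"
      using that \<Phi>c by (intro commutes_recip) auto
    then show ?thesis by (simp add: commutes_def flip: mult.assoc)
  qed
  have Bt: "fls_const (\<Phi> t) * (resolvent (p (Suc i) s) * f) = resolvent (y t s + 1) * (fls_const (\<Phi> t) * f)"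
    if "t \<in> T" "s \<in> S" for t s f
  proof -
    have "fls_const (\<Phi> t) * (Zv - fls_const (p (Suc i) s)) = (Zv - fls_const (y t s + 1)) * fls_const (\<Phi> t)"
      using that \<Phi>d[of t s]
      by (simp add: S_def left_diff_distrib right_diff_distrib fls_X_inv_times_comm fls_const_mult_const
          del: fls_plus_const)
    then have "fls_const (\<Phi> t) * resolvent (p (Suc i) s) = resolvent (y t s + 1) * fls_const (\<Phi> t)"
      unfolding ainv_Zv_diff[symmetric] by (intro ainv_intertwine two_sided_unit_Zv_diff)
    then show ?thesis by (simp flip: mult.assoc)
  qed
  have C: "\<Phi> t * (rootprod (p i) us (p (Suc i) s - 1) * a) = rootprod (p i) us (y t s) * (\<Phi> t * a)"
    if "t \<in> T" "s \<in> S" "set us \<subseteq> set (idx R i)" for t s us a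
  proof -
    have "\<Phi> t * rootprod (p i) us (p (Suc i) s - 1) = rootprod (p i) us (y t s) * \<Phi> t"
      using that \<Phi>c[of t] \<Phi>d[of t s]
      by (intro rootprod_intertwine) (auto simp: S_def algebra_simps)
    then show ?thesis by (simp flip: mult.assoc)
  qed
  have Dc: "H t * (recip i * (resolvent (y t s + 1) * f)) = resolvent (y t s + 1) * (H t * (recip i * f))"
    if "t \<in> T" "s \<in> S" for t s f
  proof -
    have "commutes (fls_const (y t s + 1)) (H t * recip i)"
      unfolding H_def using that xs[of t]
      by (intro commutes_mult_right commutes_recip commutes_rootprod_right)
        (auto simp: liftp_def intro!: commutes_left yc)
    then have "commutes (H t * recip i) (resolvent (y t s + 1))"
      by (intro commutes_resolvent) (simp add: commutes_sym)
    then show ?thesis by (simp add: commutes_def flip: mult.assoc)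
  qed
  have X: "?X = - (\<Sum>t\<in>T. \<Sum>s\<in>S. resolvent (y t s + 1)
      * (H t * recip i * fls_const (rootprod (p i) (idx R i) (y t s))) * fls_const (\<Phi> t * E s))"
    unfolding H_def[symmetric] sum_distrib_left sum_distrib_right mult_minus_right
    by (rule arg_cong[where f = uminus], subst sum.swap, intro sum.cong refl)
      (simp add: A Bt Dc C mult.assoc)
  have U: "?U = (\<Sum>t\<in>T. \<Sum>s\<in>S. B t s * fls_const (\<Phi> t * E s))"
  proof -
    have "?U = (\<Sum>r\<in>set (idx R i). \<Sum>t\<in>T. \<Sum>s\<in>S. resolvent (p i r + 1) * fls_const (ainv (denom i r)
        * rootprod (p (Suc i)) (xs t) (p i r + 1) * rootprod (p i) (without (idx R i) r) (y t s)
        * (\<Phi> t * E s)))"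
    proof (intro sum.cong refl)
      fix r assume "r \<in> set (idx R i)"
      have "set (without (idx R i) r) \<subseteq> set (idx R i)" by auto
      then have "ainv (denom i r) * (\<Sum>t\<in>T. rootprod (p (Suc i)) (xs t) (p i r + 1) * \<Phi> t)
          * (\<Sum>s\<in>S. rootprod (p i) (without (idx R i) r) (p (Suc i) s - 1) * E s)
        = (\<Sum>t\<in>T. \<Sum>s\<in>S. ainv (denom i r) * rootprod (p (Suc i)) (xs t) (p i r + 1)
          * rootprod (p i) (without (idx R i) r) (y t s) * (\<Phi> t * E s))"
        unfolding sum_distrib_left sum_distrib_right
        by (subst sum.swap, intro sum.cong refl) (simp add: C mult.assoc)
      then show "resolvent (p i r + 1) * fls_const (ainv (denom i r)
          * (\<Sum>t\<in>T. rootprod (p (Suc i)) (xs t) (p i r + 1) * \<Phi> t)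
          * (\<Sum>s\<in>S. rootprod (p i) (without (idx R i) r) (p (Suc i) s - 1) * E s))
        = (\<Sum>t\<in>T. \<Sum>s\<in>S. resolvent (p i r + 1) * fls_const (ainv (denom i r)
        * rootprod (p (Suc i)) (xs t) (p i r + 1) * rootprod (p i) (without (idx R i) r) (y t s)
        * (\<Phi> t * E s)))"
        by (simp add: fls_const_sum sum_distrib_left)
    qed
    also have "\<dots> = (\<Sum>t\<in>T. \<Sum>r\<in>set (idx R i). \<Sum>s\<in>S. resolvent (p i r + 1) * fls_const (ainv (denom i r)
        * rootprod (p (Suc i)) (xs t) (p i r + 1) * rootprod (p i) (without (idx R i) r) (y t s)
        * (\<Phi> t * E s)))"
      by (rule sum.swap)
    also have "\<dots> = (\<Sum>t\<in>T. \<Sum>s\<in>S. B t s * fls_const (\<Phi> t * E s))"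
      unfolding B_def sum_distrib_right
      by (rule sum.cong[OF refl], subst sum.swap) (simp add: mult.assoc flip: fls_const_mult_const)
    finally show ?thesis .
  qed
  have "?X - ?U + ?Z = - (\<Sum>t\<in>T. \<Sum>s\<in>S. (B t s - G t s) * fls_const (\<Phi> t * E s))"
    unfolding X U G_def
    by (simp add: left_diff_distrib right_diff_distrib sum_subtractf mult.assoc flip: fls_const_mult_const)
  then show ?thesis using reg by simp
qed

text \<open>The counterpart of \<open>telescope_step_aux\<close> for e = 1: without a resolvent on
  the right, no poles are passed on to a next level.\<close>

lemma telescope_end_aux:
  fixes \<Phi> :: "nat \<Rightarrow> 'a" and T :: "nat set" and xs :: "nat \<Rightarrow> nat list"
  assumes xs: "\<And>t. t \<in> T \<Longrightarrow> set (xs t) \<subseteq> set (idx R (Suc i))"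
    and \<Phi>c: "\<And>t r. t \<in> T \<Longrightarrow> r \<in> set (idx R i) \<Longrightarrow> commutes (\<Phi> t) (p i r)"
  shows "regular ((\<Sum>t\<in>T. rootprod (liftp p (Suc i)) (xs t) Zv * fls_const (\<Phi> t)) * recip i
    - (\<Sum>r\<in>set (idx R i). resolvent (p i r + 1) * fls_const (ainv (denom i r)
        * (\<Sum>t\<in>T. rootprod (p (Suc i)) (xs t) (p i r + 1) * \<Phi> t))))"
    (is "regular (?X - ?U)")
proof -
  define H where "H t = rootprod (liftp p (Suc i)) (xs t) Zv" for t
  define B where "B t = (\<Sum>r\<in>set (idx R i). resolvent (p i r + 1) * fls_const (ainv (denom i r)
        * rootprod (p (Suc i)) (xs t) (p i r + 1)))" for t
  have "regular (B t - H t * recip i)" if "t \<in> T" for t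
    unfolding B_def denom_def H_def recip_def liftp_conv
    using that xs[of t] by (intro bracket_regular_end) (auto intro: commutes_p two_sided_unit_p_diff)
  then have reg: "regular (- (\<Sum>t\<in>T. (B t - H t * recip i) * fls_const (\<Phi> t)))"
    by (intro regular_minus regular_sum regular_mult) auto
  have "fls_const (\<Phi> t) * recip i = recip i * fls_const (\<Phi> t)" if "t \<in> T" for t
  proof -
    have "commutes (fls_const (\<Phi> t)) (recip i)"
      using that \<Phi>c by (intro commutes_recip) auto
    then show ?thesis by (simp add: commutes_def)
  qed
  then have X: "?X = (\<Sum>t\<in>T. H t * recip i * fls_const (\<Phi> t))"
    by (simp add: H_def sum_distrib_right mult.assoc)
  have U: "?U = (\<Sum>t\<in>T. B t * fls_const (\<Phi> t))"
    unfolding B_def sum_distrib_right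
    by (subst sum.swap) (simp add: mult.assoc sum_distrib_left fls_const_sum flip: fls_const_mult_const)
  have "?X - ?U = - (\<Sum>t\<in>T. (B t - H t * recip i) * fls_const (\<Phi> t))"
    unfolding X U by (simp add: left_diff_distrib sum_subtractf)
  then show ?thesis using reg by simp
qed

lemma commutes_left_factor:
  assumes "t \<in> set (idx R k)" "u \<in> set (idx R j)" "j \<le> k"
  shows "commutes (ainv (denom k t) * f_tail n k t) (p j u)"
  using assms by (intro commutes_left(3) commutes_ainv_denom commutes_f_tail_p commutes_p)

text \<open>Moving P_k(z) to the left through \<open>em k t\<close> changes its root
  \<open>p k t\<close> into \<open>p k t + 1\<close>, which is precisely the pole of the summand
  \<open>t\<close>. The product is a polynomial in z, and P_{k,t}(z) is what remains of
  P_k(z).\<close>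

lemma fD_times_rootprod:
  "fDo R p em (Suc (k + n)) k * rootprod (liftp p k) (idx R k) Zv
    = (\<Sum>t\<in>set (idx R k). rootprod (liftp p k) (without (idx R k) t) Zv
        * fls_const (ainv (denom k t) * f_tail n k t * em k t))"
proof -
  have "resolvent (p k t + 1) * fls_const (ainv (denom k t) * f_tail n k t * em k t) * rootprod (liftp p k) (idx R k) Zv
    = rootprod (liftp p k) (without (idx R k) t) Zv * fls_const (ainv (denom k t) * f_tail n k t * em k t)"
    if t: "t \<in> set (idx R k)" for t
  proof -
    define G where "G = ainv (denom k t) * f_tail n k t"
    define M where "M = rootprod (liftp p k) (without (idx R k) t) Zv"
    have P: "rootprod (liftp p k) (idx R k) Zv = (Zv - fls_const (p k t)) * M"
      unfolding M_def liftp_conv using t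
      by (intro rootprod_remove) (auto intro!: commutes_intros commutes_p)
    have e: "fls_const (em k t) * (Zv - fls_const (p k t)) = (Zv - fls_const (p k t + 1)) * fls_const (em k t)"
      using em_p_shift[OF t]
      by (simp add: left_diff_distrib right_diff_distrib fls_X_inv_times_comm del: fls_plus_const)
    have "commutes (fls_const (em k t)) M"
      unfolding M_def liftp_conv using t by (auto intro!: commutes_intros commutes_em_p)
    then have eM: "fls_const (em k t) * M = M * fls_const (em k t)"
      by (simp add: commutes_def)
    have "commutes (fls_const G) (Zv - fls_const (p k t + 1))"
      unfolding G_def using t
      by (intro commutes_diff_right) (auto intro!: commutes_add_right commutes_left_factor)
    then have g: "fls_const G * (Zv - fls_const (p k t + 1)) = (Zv - fls_const (p k t + 1)) * fls_const G"
      by (simp add: commutes_def)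
    have "commutes (fls_const G) M"
      unfolding G_def M_def liftp_conv using t
      by (intro commutes_rootprod_right) (auto intro!: commutes_left_factor)
    then have gM: "fls_const G * M = M * fls_const G"
      by (simp add: commutes_def)
    have "resolvent (p k t + 1) * fls_const (G * em k t) * rootprod (liftp p k) (idx R k) Zv
      = resolvent (p k t + 1) * fls_const G * (fls_const (em k t) * (Zv - fls_const (p k t))) * M"
      by (simp add: P mult.assoc flip: fls_const_mult_const)
    also have "\<dots> = resolvent (p k t + 1) * (fls_const G * (Zv - fls_const (p k t + 1))) * (fls_const (em k t) * M)"
      unfolding e by (simp only: mult.assoc)
    also have "\<dots> = fls_const G * M * fls_const (em k t)"
      unfolding g eM by (simp add: ainv_mult_self_left two_sided_unit_Zv_diff mult.assoc flip: ainv_Zv_diff)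
    finally show ?thesis
      unfolding gM unfolding G_def M_def by (simp add: mult.assoc flip: fls_const_mult_const)
  qed
  then show ?thesis unfolding fDo_eq sum_distrib_right by (intro sum.cong) auto
qed

text \<open>The polar part left by the first $i$ terms of $T_D(z)_{\alpha\beta}$, up to sign.\<close>

definition carry :: "nat \<Rightarrow> nat \<Rightarrow> nat \<Rightarrow> 'a fls" where
  "carry \<alpha> \<beta> i = (\<Sum>r\<in>set (idx R i). resolvent (p i r + 1)
      * fls_const (ainv (denom i r) * f_tail (\<alpha> - Suc i) i r * e_tail (\<beta> - Suc i) i r))"

abbreviation summand :: "nat \<Rightarrow> nat \<Rightarrow> nat \<Rightarrow> 'a fls" where
  "summand \<alpha> \<beta> k \<equiv> fD R p em \<alpha> k * gD R p k * eD R p ep k \<beta>"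

lemma commutes_left_coeff:
  assumes "t \<in> set (idx R (Suc i))" "r \<in> set (idx R i)"
  shows "commutes (ainv (denom (Suc i) t) * f_tail n (Suc i) t * em (Suc i) t) (p i r)"
  using assms by (auto intro!: commutes_left(3)[OF commutes_left_factor] commutes_em_p)

text \<open>\<open>em k t\<close> raises \<open>p k t\<close> by 1 and fixes the other variables.
  The result is written as y + 1 because it is \<open>p k s - 1\<close>, the argument of the
  numerators of e, that is sent to y.\<close>

lemma left_coeff_shift:
  assumes t: "t \<in> set (idx R k)" and s: "s \<in> set (idx R k)"
  shows "ainv (denom k t) * f_tail n k t * em k t * p k s
    = ((if s = t then p k s else p k s - 1) + 1) * (ainv (denom k t) * f_tail n k t * em k t)"
proof -
  have "em k t * p k s = ((if s = t then p k s else p k s - 1) + 1) * em k t"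
    using em_p_shift[OF t] commutes_em_p(1)[OF t s] by (auto simp: commutes_def)
  then have "ainv (denom k t) * f_tail n k t * em k t * p k s
    = ainv (denom k t) * f_tail n k t * ((if s = t then p k s else p k s - 1) + 1) * em k t"
    by (simp only: mult.assoc)
  moreover have "commutes (ainv (denom k t) * f_tail n k t) ((if s = t then p k s else p k s - 1) + 1)"
    using commutes_left_factor[OF t s] by (auto intro!: commutes_add_right)
  ultimately show ?thesis by (simp only: commutes_def mult.assoc[symmetric])
qed

text \<open>The form of \<alpha> and \<beta> says that i+1 is below both. In the double sum over t
  and s, a term with s \<noteq> t dies because \<open>y t s + 1 = p (Suc i) s\<close> is a root of
  P_{i+1,t}. For s = t the exponentials cancel by \<open>em_denom_ep\<close>, and the shifted
  denominator cancels against the numerator at \<open>p (Suc i) t + 1\<close>.\<close>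

lemma telescope_step:
  "regular (summand (Suc (Suc i + n)) (Suc (Suc i + m)) (Suc i) - carry (Suc (Suc i + n)) (Suc (Suc i + m)) i
      + carry (Suc (Suc i + n)) (Suc (Suc i + m)) (Suc i))"
proof -
  define \<Phi> where "\<Phi> t = ainv (denom (Suc i) t) * f_tail n (Suc i) t * em (Suc i) t" for t
  define E where "E s = ainv (denom (Suc i) s) * ep (Suc i) s * e_tail m (Suc i) s" for s
  define y where "y t s = (if s = t then p (Suc i) s else p (Suc i) s - 1)" for t s
  define S where "S = set (idx R (Suc i))"
  have "regular ((\<Sum>t\<in>S. rootprod (liftp p (Suc i)) (without (idx R (Suc i)) t) Zv * fls_const (\<Phi> t)) * recip i
      * - (\<Sum>s\<in>S. resolvent (p (Suc i) s) * fls_const (rootprod (p i) (idx R i) (p (Suc i) s - 1) * E s))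
    - (\<Sum>r\<in>set (idx R i). resolvent (p i r + 1) * fls_const (ainv (denom i r)
        * (\<Sum>t\<in>S. rootprod (p (Suc i)) (without (idx R (Suc i)) t) (p i r + 1) * \<Phi> t)
        * (\<Sum>s\<in>S. rootprod (p i) (without (idx R i) r) (p (Suc i) s - 1) * E s)))
    + (\<Sum>t\<in>S. \<Sum>s\<in>S. resolvent (y t s + 1)
        * fls_const (rootprod (p (Suc i)) (without (idx R (Suc i)) t) (y t s + 1) * \<Phi> t * E s)))"
    unfolding S_def
    by (rule telescope_step_aux) (auto simp: \<Phi>_def y_def commutes_left_coeff left_coeff_shift)
  moreover have "(\<Sum>t\<in>S. \<Sum>s\<in>S. resolvent (y t s + 1)
        * fls_const (rootprod (p (Suc i)) (without (idx R (Suc i)) t) (y t s + 1) * \<Phi> t * E s))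
      = carry (Suc (Suc i + n)) (Suc (Suc i + m)) (Suc i)"
  proof -
    have "rootprod (p (Suc i)) (without (idx R (Suc i)) t) (y t s + 1) * \<Phi> t * E s
      = (if s = t then ainv (denom (Suc i) t) * f_tail n (Suc i) t * e_tail m (Suc i) t else 0)"
      if t: "t \<in> S" and s: "s \<in> S" for t s
    proof (cases "s = t")
      case True
      have "commutes (ainv (denom (Suc i) t) * f_tail n (Suc i) t) (denom_shift (Suc i) t)"
        using t unfolding denom_shift_def S_def
        by (intro commutes_rootprod_right) (auto intro!: commutes_add_right commutes_left_factor)
      then have c: "denom_shift (Suc i) t * (ainv (denom (Suc i) t) * (f_tail n (Suc i) t * f))
          = ainv (denom (Suc i) t) * (f_tail n (Suc i) t * (denom_shift (Suc i) t * f))" for f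
        by (simp add: commutes_def flip: mult.assoc)
      have e: "em (Suc i) t * (ainv (denom (Suc i) t) * (ep (Suc i) t * f)) = ainv (denom_shift (Suc i) t) * f" for f
        using em_denom_ep[of t "Suc i"] t by (simp add: S_def flip: mult.assoc)
      show ?thesis
        using True two_sided_unit_denom_shift[of t "Suc i"] t
        by (simp add: y_def \<Phi>_def E_def denom_shift_def[symmetric] c e ainv_mult_self_left S_def mult.assoc)
    next
      case False
      then have "rootprod (p (Suc i)) (without (idx R (Suc i)) t) (y t s + 1) = 0"
        using s by (intro rootprod_eq_0[of s]) (auto simp: y_def S_def)
      then show ?thesis using False by simp
    qed
    then have "(\<Sum>t\<in>S. \<Sum>s\<in>S. resolvent (y t s + 1)
        * fls_const (rootprod (p (Suc i)) (without (idx R (Suc i)) t) (y t s + 1) * \<Phi> t * E s))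
      = (\<Sum>t\<in>S. \<Sum>s\<in>S. if s = t then resolvent (p (Suc i) t + 1)
          * fls_const (ainv (denom (Suc i) t) * f_tail n (Suc i) t * e_tail m (Suc i) t) else 0)"
      by (intro sum.cong refl) (auto simp: y_def)
    then show ?thesis by (simp add: carry_def S_def)
  qed
  ultimately show ?thesis
    unfolding fD_def eD_def gD_eq
    using fD_times_rootprod[of "Suc i" n] eDo_eq[of "Suc i" m]
    by (simp add: carry_def S_def \<Phi>_def E_def mult.assoc[symmetric] Suc_diff_le)
qed

text \<open>With f = 1 nothing shifts \<open>p (Suc i) s\<close>, so every pole of e is a root of
  the full product P_{i+1}(z) and none survives. The index set \<open>{0}\<close> is the dummy
  singleton, with \<Phi> = 1.\<close>

lemma telescope_end_row:
  "regular (summand (Suc i) (Suc (Suc i + m)) (Suc i) - carry (Suc i) (Suc (Suc i + m)) i)"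
proof -
  define E where "E s = ainv (denom (Suc i) s) * ep (Suc i) s * e_tail m (Suc i) s" for s
  define y where "y t s = p (Suc i) s - 1" for t s :: nat
  have "regular ((\<Sum>t\<in>{0::nat}. rootprod (liftp p (Suc i)) (idx R (Suc i)) Zv * fls_const 1) * recip i
      * - (\<Sum>s\<in>set (idx R (Suc i)). resolvent (p (Suc i) s) * fls_const (rootprod (p i) (idx R i) (p (Suc i) s - 1) * E s))
    - (\<Sum>r\<in>set (idx R i). resolvent (p i r + 1) * fls_const (ainv (denom i r)
        * (\<Sum>t\<in>{0::nat}. rootprod (p (Suc i)) (idx R (Suc i)) (p i r + 1) * 1)
        * (\<Sum>s\<in>set (idx R (Suc i)). rootprod (p i) (without (idx R i) r) (p (Suc i) s - 1) * E s)))
    + (\<Sum>t\<in>{0::nat}. \<Sum>s\<in>set (idx R (Suc i)). resolvent (y t s + 1)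
        * fls_const (rootprod (p (Suc i)) (idx R (Suc i)) (y t s + 1) * 1 * E s)))"
    by (rule telescope_step_aux) (auto simp: y_def)
  moreover have "(\<Sum>t\<in>{0::nat}. \<Sum>s\<in>set (idx R (Suc i)). resolvent (y t s + 1)
        * fls_const (rootprod (p (Suc i)) (idx R (Suc i)) (y t s + 1) * 1 * E s)) = 0"
    by (auto intro!: sum.neutral simp: y_def rootprod_eq_0[where c = "p (Suc i)"])
  ultimately show ?thesis
    unfolding fD_def eD_def gD_eq
    using eDo_eq[of "Suc i" m]
    by (simp add: carry_def E_def mult.assoc[symmetric] Suc_diff_le)
qed

lemma telescope_end_column:
  "regular (summand (Suc (Suc i + n)) (Suc i) (Suc i) - carry (Suc (Suc i + n)) (Suc i) i)"
proof -
  define \<Phi> where "\<Phi> t = ainv (denom (Suc i) t) * f_tail n (Suc i) t * em (Suc i) t" for t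
  define S where "S = set (idx R (Suc i))"
  have "regular ((\<Sum>t\<in>S. rootprod (liftp p (Suc i)) (without (idx R (Suc i)) t) Zv * fls_const (\<Phi> t)) * recip i
    - (\<Sum>r\<in>set (idx R i). resolvent (p i r + 1) * fls_const (ainv (denom i r)
        * (\<Sum>t\<in>S. rootprod (p (Suc i)) (without (idx R (Suc i)) t) (p i r + 1) * \<Phi> t))))"
    unfolding S_def
    by (rule telescope_end_aux) (auto simp: \<Phi>_def commutes_left_coeff)
  then show ?thesis
    unfolding fD_def eD_def gD_eq
    using fD_times_rootprod[of "Suc i" n]
    by (simp add: carry_def S_def \<Phi>_def mult.assoc[symmetric] Suc_diff_le)
qed

lemma telescope_end_diagonal: "regular (summand (Suc i) (Suc i) (Suc i) - carry (Suc i) (Suc i) i)"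
proof -
  have "regular ((\<Sum>t\<in>{0::nat}. rootprod (liftp p (Suc i)) (idx R (Suc i)) Zv * fls_const 1) * recip i
    - (\<Sum>r\<in>set (idx R i). resolvent (p i r + 1) * fls_const (ainv (denom i r)
        * (\<Sum>t\<in>{0::nat}. rootprod (p (Suc i)) (idx R (Suc i)) (p i r + 1) * 1))))"
    by (rule telescope_end_aux) auto
  then show ?thesis
    unfolding fD_def eD_def gD_eq by (simp add: carry_def)
qed

lemma telescope_end:
  assumes "Suc i = min \<alpha> \<beta>"
  shows "regular (summand \<alpha> \<beta> (Suc i) - carry \<alpha> \<beta> i)"
proof (cases "\<alpha> = \<beta>")
  case True
  then show ?thesis using assms telescope_end_diagonal[of i] by simp
next
  case False
  then consider "\<beta> = Suc i" "Suc i < \<alpha>" | "\<alpha> = Suc i" "Suc i < \<beta>"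
    using assms by linarith
  then show ?thesis
    by cases (auto dest!: less_imp_Suc_add simp: telescope_end_row telescope_end_column
        simp del: add_Suc)
qed

lemma telescope_partial:
  assumes "j < min \<alpha> \<beta>"
  shows "regular ((\<Sum>i\<in>{1..j}. summand \<alpha> \<beta> i) + carry \<alpha> \<beta> j)"
  using assms
proof (induction j)
  \<comment> \<open>\<open>aa R 0 = 0\<close> makes the initial carry an empty sum.\<close>
  case 0
  then show ?case by (simp add: carry_def idx_def aa_def)
next
  case (Suc j)
  then obtain n m where nm: "\<alpha> = Suc (Suc j + n)" "\<beta> = Suc (Suc j + m)"
    using less_iff_Suc_add[of "Suc j" \<alpha>] less_iff_Suc_add[of "Suc j" \<beta>] by auto
  have "regular (((\<Sum>i\<in>{1..j}. summand \<alpha> \<beta> i) + carry \<alpha> \<beta> j) + (summand \<alpha> \<beta> (Suc j) - carry \<alpha> \<beta> j + carry \<alpha> \<beta> (Suc j)))"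
    using telescope_step[of j n m] unfolding nm[symmetric]
    by (rule regular_add[rotated]) (use Suc in auto)
  then show ?case by (simp add: add_ac)
qed

theorem TD_regular:
  assumes "\<alpha> \<ge> 1" "\<beta> \<ge> 1"
  shows "regular (TD R p ep em \<alpha> \<beta>)"
proof -
  obtain j where j: "Suc j = min \<alpha> \<beta>"
    using assms by (cases "min \<alpha> \<beta>") auto
  have "regular (((\<Sum>i\<in>{1..j}. summand \<alpha> \<beta> i) + carry \<alpha> \<beta> j) + (summand \<alpha> \<beta> (Suc j) - carry \<alpha> \<beta> j))"
    using j by (intro regular_add telescope_partial telescope_end) auto
  then show ?thesis unfolding TD_def j[symmetric] by simp
qed

section \<open>Expansion of the blocks at infinity\<close>

text \<open>The degree of g_k in z is a_k - a_{k-1}, the slope of the tent function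
  \<open>aa\<close>: it is 1 up to R and -1 beyond. This change of slope is the source of the block
  structure.\<close>

lemma has_lead_gD:
  assumes "1 \<le> k" "k \<le> 2 * R"
  shows "has_lead (if k \<le> R then - 1 else 1) 1 (gD R p k)"
proof -
  obtain i where k: "k = Suc i" using assms by (cases k) auto
  have "has_lead (int (aa R i) - int (aa R (Suc i))) 1 (gD R p k)"
    using has_lead_mult[OF has_lead_rootprod[of "idx R (Suc i)" "p (Suc i)"] has_lead_ainv_rootprod[of "idx R i" "p i"]]
    unfolding k gD_eq recip_def liftp_conv by simp
  moreover have "int (aa R i) - int (aa R (Suc i)) = (if k \<le> R then - 1 else 1)"
    using assms by (auto simp: k aa_def min_def)
  ultimately show ?thesis by simp
qed

lemma has_lead_fD:
  assumes "k \<le> \<alpha>"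
  shows "has_lead (if k = \<alpha> then 0 else 1) (if k = \<alpha> then 1 else fls_nth (fD R p em \<alpha> k) 1) (fD R p em \<alpha> k)"
proof (cases "k = \<alpha>")
  case False
  then obtain n where n: "\<alpha> = Suc (k + n)" using assms less_imp_Suc_add[of k \<alpha>] by auto
  have "has_lead 1 (fls_nth (fDo R p em \<alpha> k) 1) (fDo R p em \<alpha> k)"
    unfolding n fDo_eq by (rule has_lead_nth[OF has_lead_sum_resolvent])
  then show ?thesis using False by (simp add: fD_def)
qed (simp add: fD_def has_lead_one)

lemma has_lead_eD:
  assumes "k \<le> \<beta>"
  shows "has_lead (if k = \<beta> then 0 else 1) (if k = \<beta> then 1 else fls_nth (eD R p ep k \<beta>) 1) (eD R p ep k \<beta>)"
proof (cases "k = \<beta>")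
  case False
  then obtain n where n: "\<beta> = Suc (k + n)" using assms less_imp_Suc_add[of k \<beta>] by auto
  have "has_lead 1 (fls_nth (eDo R p ep k \<beta>) 1) (eDo R p ep k \<beta>)"
    unfolding n eDo_eq by (rule has_lead_nth[OF has_lead_minus[OF has_lead_sum_resolvent]])
  then show ?thesis using False by (simp add: eD_def)
qed (simp add: eD_def has_lead_one)

lemma has_lead_summand:
  assumes "1 \<le> k" "k \<le> \<alpha>" "k \<le> \<beta>" "k \<le> 2 * R"
  shows "has_lead ((if k = \<alpha> then 0 else 1) + (if k \<le> R then - 1 else 1) + (if k = \<beta> then 0 else 1))
    ((if k = \<alpha> then 1 else fls_nth (fD R p em \<alpha> k) 1) * (if k = \<beta> then 1 else fls_nth (eD R p ep k \<beta>) 1))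
    (summand \<alpha> \<beta> k)"
  using has_lead_mult[OF has_lead_mult[OF has_lead_fD[OF assms(2)] has_lead_gD[OF assms(1,4)]] has_lead_eD[OF assms(3)]]
  by (simp only: mult_1_right)

text \<open>For k < \<gamma> both f and e are off the diagonal, and the summand has order 1 - 1 + 1
  = 1 in z^{-1}. Only k = \<gamma>, where e = 1, reaches order 0.\<close>

lemma TD_lower_left:
  assumes "\<alpha> \<in> {R + 1..2 * R}" "\<gamma> \<in> {1..R}"
  shows "has_lead 0 (fls_nth (fD R p em \<alpha> \<gamma>) 1) (TD R p ep em \<alpha> \<gamma>)"
proof -
  have "has_lead 0 (if k = \<gamma> then fls_nth (fD R p em \<alpha> \<gamma>) 1 else 0) (summand \<alpha> \<gamma> k)" if "k \<in> {1..min \<alpha> \<gamma>}" for k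
    using has_lead_summand[of k \<alpha> \<gamma>] that assms by (auto simp: has_lead_def split: if_splits)
  then have "has_lead 0 (\<Sum>k\<in>{1..min \<alpha> \<gamma>}. if k = \<gamma> then fls_nth (fD R p em \<alpha> \<gamma>) 1 else 0) (TD R p ep em \<alpha> \<gamma>)"
    unfolding TD_def by (intro has_lead_sum)
  then show ?thesis using assms by simp
qed

lemma TD_upper_right:
  assumes "\<gamma> \<in> {1..R}" "\<beta> \<in> {R + 1..2 * R}"
  shows "has_lead 0 (fls_nth (eD R p ep \<gamma> \<beta>) 1) (TD R p ep em \<gamma> \<beta>)"
proof -
  have "has_lead 0 (if k = \<gamma> then fls_nth (eD R p ep \<gamma> \<beta>) 1 else 0) (summand \<gamma> \<beta> k)" if "k \<in> {1..min \<gamma> \<beta>}" for k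
    using has_lead_summand[of k \<gamma> \<beta>] that assms by (auto simp: has_lead_def split: if_splits)
  then have "has_lead 0 (\<Sum>k\<in>{1..min \<gamma> \<beta>}. if k = \<gamma> then fls_nth (eD R p ep \<gamma> \<beta>) 1 else 0) (TD R p ep em \<gamma> \<beta>)"
    unfolding TD_def by (intro has_lead_sum)
  then show ?thesis using assms by simp
qed

text \<open>Every k \<le> R contributes at order 1 - 1 + 1 = 1. For k > R the factor g already has
  order 1, so f and e must both be 1; this forces k = \<alpha> = \<beta> and yields the Kronecker
  delta.\<close>

lemma TD_lower_right:
  assumes "\<alpha> \<in> {R + 1..2 * R}" "\<beta> \<in> {R + 1..2 * R}"
  shows "fls_nth (TD R p ep em \<alpha> \<beta>) 1
    = (\<Sum>\<gamma>\<in>{1..R}. fls_nth (fD R p em \<alpha> \<gamma>) 1 * fls_nth (eD R p ep \<gamma> \<beta>) 1) + (if \<alpha> = \<beta> then 1 else 0)"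
proof -
  have "{1..min \<alpha> \<beta>} = {1..R} \<union> {R<..min \<alpha> \<beta>}" using assms by auto
  then have "fls_nth (TD R p ep em \<alpha> \<beta>) 1
    = (\<Sum>k\<in>{1..R}. fls_nth (summand \<alpha> \<beta> k) 1) + (\<Sum>k\<in>{R<..min \<alpha> \<beta>}. fls_nth (summand \<alpha> \<beta> k) 1)"
    unfolding TD_def fls_nth_sum by (simp only:) (rule sum.union_disjoint; auto)
  moreover have "fls_nth (summand \<alpha> \<beta> k) 1 = fls_nth (fD R p em \<alpha> k) 1 * fls_nth (eD R p ep k \<beta>) 1" if "k \<in> {1..R}" for k
    using has_lead_summand[of k \<alpha> \<beta>] that assms by (auto simp: has_lead_def split: if_splits)
  moreover have "fls_nth (summand \<alpha> \<beta> k) 1 = (if k = \<alpha> \<and> \<alpha> = \<beta> then 1 else 0)" if "k \<in> {R<..min \<alpha> \<beta>}" for k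
  proof -
    have k: "\<not> k \<le> R" "1 \<le> k" "k \<le> \<alpha>" "k \<le> \<beta>" "k \<le> 2 * R"
      using that assms by auto
    define l :: int where "l = (if k = \<alpha> then 0 else 1) + 1 + (if k = \<beta> then 0 else 1)"
    define c where "c = (if k = \<alpha> then 1 else fls_nth (fD R p em \<alpha> k) 1) * (if k = \<beta> then 1 else fls_nth (eD R p ep k \<beta>) 1)"
    have lead: "has_lead l c (summand \<alpha> \<beta> k)"
      using has_lead_summand[OF k(2-5)] unfolding l_def c_def by (simp only: k(1) if_False)
    show ?thesis
    proof (cases "k = \<alpha> \<and> \<alpha> = \<beta>")
      case True
      then have "l = 1" "c = 1" by (simp_all add: l_def c_def)
      then show ?thesis using lead unfolding has_lead_def by (simp only: True if_True simp_thms)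
    next
      case False
      then have "1 < l" by (auto simp: l_def)
      then show ?thesis using lead False unfolding has_lead_def by (simp only: if_False)
    qed
  qed
  ultimately show ?thesis using assms by (cases "\<alpha> = \<beta>") simp_all
qed

end

theorem theorem2p38:
  fixes R :: nat
    and p ep em :: "nat \<Rightarrow> nat \<Rightarrow> 'a::ring_1"
    and \<phi> :: "complex \<Rightarrow> 'a"
  assumes "R \<ge> 1"
    and "calg \<phi>"
    and "A_rels R p ep em"
  shows "(\<forall>\<alpha> \<in> {R + 1..2 * R}. \<forall>\<beta> \<in> {1..R}. \<forall>d::int. d \<noteq> 0 \<longrightarrow> fls_nth (TD R p ep em \<alpha> \<beta>) d = 0)
       \<and> (\<forall>\<alpha> \<in> {1..R}. \<forall>\<beta> \<in> {R + 1..2 * R}. \<forall>d::int. d \<noteq> 0 \<longrightarrow> fls_nth (TD R p ep em \<alpha> \<beta>) d = 0)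
       \<and> (\<forall>j \<in> {1..R}. \<forall>l \<in> {1..R}.
            (\<Sum>\<gamma> \<in> {1..R}. fls_nth (TD R p ep em (R + j) \<gamma>) 0 * fls_nth (TD R p ep em \<gamma> (R + l)) 0)
              = (if j = l then -1 else 0))"
proof -
  interpret difference_operators R p ep em by unfold_locales fact
  \<comment> \<open>\<open>fls_nth\<close> at \<open>d\<close> is the coefficient of z^{-d}: the
    order at infinity excludes d < 0 and regularity excludes d > 0.\<close>
  have const: "fls_nth (TD R p ep em \<alpha> \<beta>) d = 0"
    if "has_lead 0 c (TD R p ep em \<alpha> \<beta>)" "\<alpha> \<ge> 1" "\<beta> \<ge> 1" "d \<noteq> 0" for \<alpha> \<beta> c and d :: int
    using that TD_regular[of \<alpha> \<beta>] by (cases "d > 0") (auto simp: has_lead_def regular_def)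
  have "(\<Sum>\<gamma> \<in> {1..R}. fls_nth (TD R p ep em (R + j) \<gamma>) 0 * fls_nth (TD R p ep em \<gamma> (R + l)) 0)
      = (if j = l then -1 else 0)" if "j \<in> {1..R}" "l \<in> {1..R}" for j l
  proof -
    have "(\<Sum>\<gamma> \<in> {1..R}. fls_nth (TD R p ep em (R + j) \<gamma>) 0 * fls_nth (TD R p ep em \<gamma> (R + l)) 0)
      = (\<Sum>\<gamma>\<in>{1..R}. fls_nth (fD R p em (R + j) \<gamma>) 1 * fls_nth (eD R p ep \<gamma> (R + l)) 1)"
      using that TD_lower_left[of "R + j"] TD_upper_right[of _ "R + l"]
      by (intro sum.cong) (auto simp: has_lead_def)
    moreover have "fls_nth (TD R p ep em (R + j) (R + l)) 1 = 0"
      using TD_regular[of "R + j" "R + l"] that by (auto simp: regular_def)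
    ultimately show ?thesis
      using TD_lower_right[of "R + j" "R + l"] that by (auto simp: eq_neg_iff_add_eq_0)
  qed
  moreover have "fls_nth (TD R p ep em \<alpha> \<beta>) d = 0"
    if "\<alpha> \<in> {R + 1..2 * R}" "\<beta> \<in> {1..R}" "d \<noteq> 0" for \<alpha> \<beta> and d :: int
    using const[OF TD_lower_left[OF that(1,2)]] that by auto
  moreover have "fls_nth (TD R p ep em \<alpha> \<beta>) d = 0"
    if "\<alpha> \<in> {1..R}" "\<beta> \<in> {R + 1..2 * R}" "d \<noteq> 0" for \<alpha> \<beta> and d :: int
    using const[OF TD_upper_right[OF that(1,2)]] that by auto
  ultimately show ?thesis by blast
qed

end
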